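(* Let $n\in\mathbf{N}$. The combing algorithm defines a bijection, and the uncombing algorithm defines the inverse bijection, between on one hand the set of cliff-shaped Schröder $n$-families, encoded by the corresponding strictly lower triangular matrices $B$ with entries in $\{0,1\}$, and on the other hand the set of disjoint Schröder $n$-families, encoded by the corresponding pairs $(B,D)$.
   Context: **Paths.** A Schröder-type path from $p$ to $q$ is a sequence $(p_0,\ldots,p_k)$ of points of $\mathbf{Z}\times\mathbf{Z}$ with $k\in\mathbf{N}$, $p_0=p$, $p_k=q$, and each $p_{i+1}-p_i\in\{(0,+1),(-1,+1),(-1,0)\}$; these steps are called horizontal, diagonal and vertical respectively. Its support is the set $\{p_0,\ldots,p_k\}$. Column $j$ is the set of points with second coordinate $j$. An $n$-family is an $n$-tuple $(P_0,\ldots,P_{n-1})$ with $P_i$ a Schröder-type path from $(i,0)$ to $(0,i)$. It is disjoint if the supports of the $P_i$ are pairwise disjoint. It is a Schröder $n$-family if for each $i$ every point $(k,l)$ in the support of $P_i$ satisfies $k+l\ge i$. A path from $(i,0)$ to $(0,i)$ is cliff-shaped if its first $i$ steps are horizontal or diagonal and any remaining steps are vertical; a cliff-shaped Schröder $n$-family is an $n$-family all of whose paths are cliff-shaped (it is then automatically a Schröder $n$-family). **Encoding.** All matrices are indexed by $[n]\times[n]$, $[n]=\{0,1,\ldots,n-1\}$. An $n$-family is encoded by a pair $(B,D)$, where $B$ is strictly lower triangular with entries in $\{0,1\}$ and $D$ is weakly lower triangular with entries in $\mathbf{N}$: for $j<i$, $B_{i,j}=0$ (resp. $1$) if the step of $P_i$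 from column $j$ to column $j+1$ is horizontal (resp. diagonal), and for $j\le i$, $D_{i,j}$ is the number of vertical steps of $P_i$ in column $j$. A cliff-shaped $n$-family is determined by $B$ alone, and every strictly lower triangular $\{0,1\}$-matrix $B$ so occurs. **Basic operations** (for $0\le k\le i<n-1$; "$\gets$" is assignment). Procedure untangle$(i,k)$: set $cur\gets0$, $d\gets0$. For $j$ from $0$ up to $k-1$: set $cur\gets cur+B[i+1,j]-B[i,j]$; if $cur>d$ then set $d\gets cur$, $B[i,j]\gets1$, $B[i+1,j]\gets0$. After the loop set $D[i,k]\gets D[i,k]-d$ and $D[i+1,k]\gets d$. Procedure cliffify$(i,k)$ (also uses an auxiliary integer array $h$): set $d\gets D[i+1,k]$ and $cur\gets h[i+1]-h[i]-1$; set $D[i+1,k]\gets0$, $D[i,k]\gets D[i,k]+d$; set $h[i+1]\gets h[i+1]-d$, $h[i]\gets h[i]+d$. Then for $j$ from $k-1$ down to $0$: set $cur\gets cur+B[i+1,j]-B[i,j]$; if $cur<d$ then set $d\gets cur$, $B[i,j]\gets0$, $B[i+1,j]\gets1$. **Combing algorithm** (input $B$; output the final pair $(B,D)$). For $k$ from $n-1$ down to $0$: set $D[k,k]\gets k-\sum_{0\le j<k}B[k,j]$; then for $i$ from $k$ up to $n-2$ execute untangle$(i,k)$. (Every weakly lower triangular entry of $D$ is assigned before being read.) **Uncombing algorithm** (input $(B,D)$; output the final $B$). For $k$ from $0$ up to $n-1$: for $i$ from $n-1$ down to $k$: if $k=0$ set $h[i]\gets i$, otherwise set $h[i]\gets h[i]-B[i,k-1]$;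 then, if $i<n-1$, execute cliffify$(i,k)$. *)

theory Defs
  imports "HOL-Library.Product_Plus"
begin

section \<open>Schroeder-type paths and families\<close>

type_synonym point = "int \<times> int"

definition horizontal :: point where "horizontal = (0, 1)"
definition diagonal :: point where "diagonal = (-1, 1)"
definition vertical :: point where "vertical = (-1, 0)"

definition steps :: "point list \<Rightarrow> (point \<times> point) list" where
  "steps P = zip P (tl P)"

definition schroeder_path :: "point \<Rightarrow> point \<Rightarrow> point list \<Rightarrow> bool" where
  "schroeder_path p q P \<longleftrightarrow> P \<noteq> [] \<and> hd P = p \<and> last P = q \<and>
     (\<forall>(a, b) \<in> set (steps P). b - a \<in> {horizontal, diagonal, vertical})"

definition nfamily :: "nat \<Rightarrow> point list list \<Rightarrow> bool" where
  "nfamily n Ps \<longleftrightarrow> length Ps = n \<and>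
     (\<forall>i<n. schroeder_path (int i, 0) (0, int i) (Ps ! i))"

definition disjoint_nfamily :: "nat \<Rightarrow> point list list \<Rightarrow> bool" where
  "disjoint_nfamily n Ps \<longleftrightarrow> nfamily n Ps \<and>
     (\<forall>i<n. \<forall>j<n. i \<noteq> j \<longrightarrow> set (Ps ! i) \<inter> set (Ps ! j) = {})"

definition schroeder_nfamily :: "nat \<Rightarrow> point list list \<Rightarrow> bool" where
  "schroeder_nfamily n Ps \<longleftrightarrow> nfamily n Ps \<and>
     (\<forall>i<n. \<forall>(k, l) \<in> set (Ps ! i). k + l \<ge> int i)"

definition cliff_shaped :: "nat \<Rightarrow> point list \<Rightarrow> bool" where
  "cliff_shaped i P \<longleftrightarrow>
     (\<forall>(a, b) \<in> set (take i (steps P)). b - a \<in> {horizontal, diagonal}) \<and>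
     (\<forall>(a, b) \<in> set (drop i (steps P)). b - a = vertical)"

definition cliff_nfamily :: "nat \<Rightarrow> point list list \<Rightarrow> bool" where
  "cliff_nfamily n Ps \<longleftrightarrow> nfamily n Ps \<and> (\<forall>i<n. cliff_shaped i (Ps ! i))"


section \<open>Encoding by matrices\<close>

text \<open>
  An \<open>n\<close> by \<open>n\<close> matrix is a function that vanishes outside the index range, so that
  equality of functions is equality of matrices. Entries are integers even
  where the encoding only produces natural numbers: the algorithms subtract entries, and
  subtraction must not be truncated.
\<close>

type_synonym matrix = "nat \<Rightarrow> nat \<Rightarrow> int"

definition diag_matrix :: "nat \<Rightarrow> point list list \<Rightarrow> matrix" where
  "diag_matrix n Ps = (\<lambda>i j.
     if j < i \<and> i < n \<and> (\<exists>(a, b) \<in> set (steps (Ps ! i)). snd a = int j \<and> b - a = diagonal)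
     then 1 else 0)"

definition vert_matrix :: "nat \<Rightarrow> point list list \<Rightarrow> matrix" where
  "vert_matrix n Ps = (\<lambda>i j.
     if j \<le> i \<and> i < n
     then int (length (filter (\<lambda>(a, b). snd a = int j \<and> b - a = vertical) (steps (Ps ! i))))
     else 0)"

definition encode :: "nat \<Rightarrow> point list list \<Rightarrow> matrix \<times> matrix" where
  "encode n Ps = (diag_matrix n Ps, vert_matrix n Ps)"

definition cliff_codes :: "nat \<Rightarrow> matrix set" where
  "cliff_codes n = diag_matrix n ` {Ps. cliff_nfamily n Ps}"

definition disjoint_schroeder_codes :: "nat \<Rightarrow> (matrix \<times> matrix) set" where
  "disjoint_schroeder_codes n =
     encode n ` {Ps. disjoint_nfamily n Ps \<and> schroeder_nfamily n Ps}"


section \<open>The combing and uncombing algorithms\<close>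

text \<open>
  A loop is a \<^const>\<open>fold\<close> of its body, acting on the tuple of program variables, over the list of
  values of the loop variable. Each \<open>let\<close> is an assignment.
\<close>

definition upd :: "matrix \<Rightarrow> nat \<Rightarrow> nat \<Rightarrow> int \<Rightarrow> matrix" where
  "upd A i j x = A(i := (A i)(j := x))"

definition untangle_body :: "nat \<Rightarrow> nat \<Rightarrow> matrix \<times> int \<times> int \<Rightarrow> matrix \<times> int \<times> int" where
  "untangle_body i j = (\<lambda>(B, cur, d).
     let cur = cur + B (i + 1) j - B i j
     in if cur > d then (upd (upd B i j 1) (i + 1) j 0, cur, cur) else (B, cur, d))"

definition untangle :: "nat \<Rightarrow> nat \<Rightarrow> matrix \<times> matrix \<Rightarrow> matrix \<times> matrix" where
  "untangle i k = (\<lambda>(B, D).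
     let (B, cur, d) = fold (untangle_body i) [0..<k] (B, 0, 0);
         D = upd D i k (D i k - d);
         D = upd D (i + 1) k d
     in (B, D))"

text \<open>
  The initial value of \<open>D\<close> matters only strictly above the diagonal, where it is never
  assigned and must be \<open>0\<close>.
\<close>

definition combing :: "nat \<Rightarrow> matrix \<Rightarrow> matrix \<times> matrix" where
  "combing n B =
     fold (\<lambda>k (B, D).
         let D = upd D k k (int k - (\<Sum>j<k. B k j))
         in fold (\<lambda>i. untangle i k) [k..<n - 1] (B, D))
       (rev [0..<n]) (B, \<lambda>_ _. 0)"

definition cliffify_body :: "nat \<Rightarrow> nat \<Rightarrow> matrix \<times> int \<times> int \<Rightarrow> matrix \<times> int \<times> int" where
  "cliffify_body i j = (\<lambda>(B, cur, d).
     let cur = cur + B (i + 1) j - B i j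
     in if cur < d then (upd (upd B i j 0) (i + 1) j 1, cur, cur) else (B, cur, d))"

definition cliffify ::
    "nat \<Rightarrow> nat \<Rightarrow> matrix \<times> matrix \<times> (nat \<Rightarrow> int) \<Rightarrow> matrix \<times> matrix \<times> (nat \<Rightarrow> int)" where
  "cliffify i k = (\<lambda>(B, D, h).
     let d = D (i + 1) k;
         cur = h (i + 1) - h i - 1;
         D = upd D (i + 1) k 0;
         D = upd D i k (D i k + d);
         h = h(i + 1 := h (i + 1) - d);
         h = h(i := h i + d);
         (B, cur, d) = fold (cliffify_body i) (rev [0..<k]) (B, cur, d)
     in (B, D, h))"

text \<open>The initial value of \<open>h\<close> is irrelevant: the round \<open>k = 0\<close> assigns each entry before it is read.\<close>

definition uncombing :: "nat \<Rightarrow> matrix \<times> matrix \<Rightarrow> matrix" where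
  "uncombing n = (\<lambda>(B, D).
     fst (fold (\<lambda>k. fold (\<lambda>i (B, D, h).
             let h = h(i := if k = 0 then int i else h i - B i (k - 1))
             in if i + 1 < n then cliffify i k (B, D, h) else (B, D, h))
           (rev [k..<n]))
         [0..<n] (B, D, \<lambda>_. 0)))"

end

theory Submission
  imports Defs
begin

text \<open>
  Write \<open>gap B i t\<close> for the difference of the sums of the first \<open>t\<close> entries of rows \<open>i + 1\<close> and
  \<open>i\<close> of \<open>B\<close>. In terms of prefix sums, untangling is a Pitman transform: it adds the running
  maximum \<open>M\<close> of the gap to row \<open>i\<close> and subtracts it from row \<open>i + 1\<close>, and cliffifying moves back the
  running minimum \<open>N\<close> of the negated gap, taken from the right and capped by \<open>D (i + 1) k\<close>. Since the
  entries are \<open>0\<close> or \<open>1\<close>, both loops move one unit at a time and are inverse to each other step by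
  step. The invariant
  \<open>comb_inv n k i\<close> describes exactly the states that occur in round \<open>k\<close> between the operations
  on rows \<open>(i - 1, i)\<close> and \<open>(i, i + 1)\<close>; it interpolates between arbitrary binary matrices (\<open>k = n\<close>)
  and codes of families in which each path stays strictly below the next one (\<open>k = 0\<close>), which
  are precisely the disjoint ones.
\<close>

section \<open>The two inner loops\<close>

definition psum :: "matrix \<Rightarrow> nat \<Rightarrow> nat \<Rightarrow> int" where
  "psum A r t = (\<Sum>j<t. A r j)"

lemma psum_0 [simp]: "psum A r 0 = 0"
  by (simp add: psum_def)

lemma psum_Suc: "psum A r (Suc t) = psum A r t + A r t"
  by (simp add: psum_def)

definition binary :: "matrix \<Rightarrow> bool" where
  "binary B \<longleftrightarrow> (\<forall>r j. B r j \<in> {0, 1})"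

lemma binaryD: "binary B \<Longrightarrow> B r j = 0 \<or> B r j = 1"
  by (auto simp: binary_def)

lemma binary_upd: "binary B \<Longrightarrow> x \<in> {0, 1} \<Longrightarrow> binary (upd B r j x)"
  by (auto simp: binary_def upd_def)

text \<open>The increments of \<open>M\<close> move from row \<open>i + 1\<close> to row
  \<open>i\<close>, so prefix sums over an initial segment \<open>J\<close> telescope. A general
  \<open>J\<close> also covers the partially run cliffifying loop, whose processed columns lie at
  the right end.\<close>

definition transfer :: "nat \<Rightarrow> nat set \<Rightarrow> (nat \<Rightarrow> int) \<Rightarrow> matrix \<Rightarrow> matrix" where
  "transfer i J M B = (\<lambda>r j.
     if j \<in> J \<and> r = i then B r j + (M (Suc j) - M j)
     else if j \<in> J \<and> r = Suc i then B r j - (M (Suc j) - M j)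
     else B r j)"

lemma transfer_other [simp]: "r \<noteq> i \<Longrightarrow> r \<noteq> Suc i \<Longrightarrow> transfer i J M B r = B r"
  by (auto simp: transfer_def)

lemma transfer_outside: "j \<notin> J \<Longrightarrow> transfer i J M B r j = B r j"
  by (auto simp: transfer_def)

lemma psum_other_row: "A r = A' r \<Longrightarrow> psum A r t = psum A' r t"
  by (simp add: psum_def)

lemma psum_transfer:
  assumes "t \<le> k"
  shows "psum (transfer i {..<k} M B) i t = psum B i t + M t - M 0"
    and "psum (transfer i {..<k} M B) (Suc i) t = psum B (Suc i) t - M t + M 0"
  using assms by (induction t) (auto simp: psum_Suc transfer_def)

lemma psum_transfer_total:
  assumes "k \<le> t"
  shows "psum (transfer i {..<k} M B) i t = psum B i t + M k - M 0"
    and "psum (transfer i {..<k} M B) (Suc i) t = psum B (Suc i) t - M k + M 0"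
  using assms
proof (induction rule: dec_induct)
  case base
  { case 1 show ?case by (simp add: psum_transfer) }
  { case 2 show ?case by (simp add: psum_transfer) }
next
  case (step t)
  { case 1 show ?case using step by (simp add: psum_Suc transfer_outside) }
  { case 2 show ?case using step by (simp add: psum_Suc transfer_outside) }
qed

section \<open>The untangling loop and the running maximum of the gap\<close>

definition gap :: "matrix \<Rightarrow> nat \<Rightarrow> nat \<Rightarrow> int" where
  "gap B i t = psum B (Suc i) t - psum B i t"

lemma gap_0 [simp]: "gap B i 0 = 0"
  by (simp add: gap_def)

lemma gap_Suc: "gap B i (Suc t) = gap B i t + B (Suc i) t - B i t"
  by (simp add: gap_def psum_Suc)

definition max_gap :: "matrix \<Rightarrow> nat \<Rightarrow> nat \<Rightarrow> int" where
  "max_gap B i t = Max (gap B i ` {..t})"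

lemma max_gap_0 [simp]: "max_gap B i 0 = 0"
  by (simp add: max_gap_def)

lemma max_gap_Suc: "max_gap B i (Suc t) = max (max_gap B i t) (gap B i (Suc t))"
  by (simp add: max_gap_def atMost_Suc max.commute)

lemma gap_le_max_gap: "s \<le> t \<Longrightarrow> gap B i s \<le> max_gap B i t"
  by (auto simp: max_gap_def)

lemma max_gap_le_iff: "max_gap B i t \<le> x \<longleftrightarrow> (\<forall>s\<le>t. gap B i s \<le> x)"
  by (auto simp: max_gap_def)

lemma max_gap_mono: "s \<le> t \<Longrightarrow> max_gap B i s \<le> max_gap B i t"
  by (meson gap_le_max_gap max_gap_le_iff order_trans)

lemma max_gap_nonneg: "0 \<le> max_gap B i t"
  using max_gap_mono[of 0 t B i] by simp

text \<open>A column changes the gap by at most one. When the new gap exceeds the old maximum, the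
  entries are therefore \<open>0\<close> and \<open>1\<close> and the old gap was at the maximum, so
  assigning \<open>1\<close> and \<open>0\<close> moves exactly one unit and keeps the matrix
  binary.\<close>

lemma untangle_loop:
  assumes "binary B"
  shows "fold (untangle_body i) [0..<k] (B, 0, 0) =
           (transfer i {..<k} (max_gap B i) B, gap B i k, max_gap B i k)
         \<and> binary (transfer i {..<k} (max_gap B i) B)"
proof (induction k)
  case 0
  then show ?case using assms by (auto simp: transfer_def)
next
  case (Suc k)
  let ?T = "\<lambda>k. transfer i {..<k} (max_gap B i) B"
  have T: "?T k i k = B i k" "?T k (Suc i) k = B (Suc i) k"
    by (simp_all add: transfer_def)
  have body: "untangle_body i k (?T k, gap B i k, max_gap B i k) =
      (?T (Suc k), gap B i (Suc k), max_gap B i (Suc k)) \<and> binary (?T (Suc k))"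
  proof (cases "gap B i (Suc k) > max_gap B i k")
    case True
    have eq: "B i k = 0" "B (Suc i) k = 1" "gap B i k = max_gap B i k"
      using True gap_le_max_gap[of k k B i] binaryD[OF assms, of i k] binaryD[OF assms, of "Suc i" k]
      by (auto simp: gap_Suc)
    have "upd (upd (?T k) i k 1) (Suc i) k 0 = ?T (Suc k)"
      using eq by (intro ext) (auto simp: upd_def transfer_def max_gap_Suc gap_Suc less_Suc_eq)
    moreover have "binary (upd (upd (?T k) i k 1) (Suc i) k 0)"
      using Suc by (simp add: binary_upd)
    ultimately show ?thesis
      using True eq T by (simp add: untangle_body_def Let_def gap_Suc max_gap_Suc)
  next
    case False
    have "?T k = ?T (Suc k)"
      using False by (intro ext) (auto simp: transfer_def max_gap_Suc less_Suc_eq)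
    then show ?thesis
      using False T Suc by (simp add: untangle_body_def Let_def gap_Suc max_gap_Suc)
  qed
  then show ?case using Suc by simp
qed

section \<open>The cliffifying loop and the capped running minimum\<close>

definition min_gap :: "matrix \<Rightarrow> nat \<Rightarrow> nat \<Rightarrow> int \<Rightarrow> nat \<Rightarrow> int" where
  "min_gap B i k d t = Min (insert d ((\<lambda>s. - gap B i s) ` {t..k}))"

lemma min_gap_le: "t \<le> s \<Longrightarrow> s \<le> k \<Longrightarrow> min_gap B i k d t \<le> - gap B i s"
  unfolding min_gap_def by (rule Min_le) auto

lemma min_gap_le_bound: "min_gap B i k d t \<le> d"
  by (simp add: min_gap_def)

lemma le_min_gap_iff: "x \<le> min_gap B i k d t \<longleftrightarrow> x \<le> d \<and> (\<forall>s. t \<le> s \<and> s \<le> k \<longrightarrow> x \<le> - gap B i s)"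
  by (auto simp: min_gap_def)

lemma min_gap_mono: "s \<le> t \<Longrightarrow> min_gap B i k d s \<le> min_gap B i k d t"
  by (meson le_min_gap_iff min_gap_le min_gap_le_bound order_trans)

lemma min_gap_rec: "t < k \<Longrightarrow> min_gap B i k d t = min (- gap B i t) (min_gap B i k d (Suc t))"
proof -
  assume "t < k"
  then have *: "{t..k} = insert t {Suc t..k}" by auto
  have "insert d ((\<lambda>s. - gap B i s) ` {t..k}) =
      insert (- gap B i t) (insert d ((\<lambda>s. - gap B i s) ` {Suc t..k}))"
    unfolding * image_insert by (rule insert_commute)
  then show ?thesis
    unfolding min_gap_def
    by (simp only: Min_insert finite_insert finite_imageI finite_atLeastAtMost insert_not_empty
          not_False_eq_True)
qed

lemma min_gap_last: "d \<le> - gap B i k \<Longrightarrow> min_gap B i k d k = d"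
  by (simp add: min_gap_def)

text \<open>The mirror image of \<open>untangle_loop\<close>: from the right, \<open>cur\<close>
  runs through the negated gaps and \<open>d\<close> through their capped minimum. The bound on
  \<open>d\<close> gives \<open>d \<le> cur\<close> at the start, so \<open>d\<close> again drops by
  one at a time. The sign of \<open>N\<close> makes the units move from row \<open>i\<close> to row
  \<open>i + 1\<close>.\<close>

lemma cliffify_loop:
  assumes bin: "binary B" and d: "d \<le> - gap B i k" and "m \<le> k"
  defines "N \<equiv> \<lambda>t. - min_gap B i k d t"
  shows "fold (cliffify_body i) (rev [m..<k]) (B, - gap B i k, d) =
           (transfer i {m..<k} N B, - gap B i m, min_gap B i k d m)
         \<and> binary (transfer i {m..<k} N B)"
  using \<open>m \<le> k\<close>
proof (induction rule: inc_induct)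
  case base
  then show ?case using bin d by (simp add: transfer_def min_gap_last)
next
  case (step m)
  let ?T = "\<lambda>m. transfer i {m..<k} N B"
  have T: "?T (Suc m) i m = B i m" "?T (Suc m) (Suc i) m = B (Suc i) m"
    by (simp_all add: transfer_def)
  have N: "min_gap B i k d m = min (- gap B i m) (min_gap B i k d (Suc m))"
    using step by (simp add: min_gap_rec)
  have body: "cliffify_body i m (?T (Suc m), - gap B i (Suc m), min_gap B i k d (Suc m)) =
      (?T m, - gap B i m, min_gap B i k d m) \<and> binary (?T m)"
  proof (cases "- gap B i m < min_gap B i k d (Suc m)")
    case True
    have eq: "B i m = 1" "B (Suc i) m = 0" "- gap B i (Suc m) = min_gap B i k d (Suc m)"
      using True min_gap_le[of "Suc m" "Suc m" k B i d] step binaryD[OF bin, of i m]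
        binaryD[OF bin, of "Suc i" m] by (auto simp: gap_Suc)
    have "upd (upd (?T (Suc m)) i m 0) (Suc i) m 1 = ?T m"
    proof (intro ext)
      fix r j
      show "upd (upd (?T (Suc m)) i m 0) (Suc i) m 1 r j = ?T m r j"
        using eq step N by (cases "j = m") (auto simp: upd_def transfer_def N_def gap_Suc)
    qed
    moreover have "binary (upd (upd (?T (Suc m)) i m 0) (Suc i) m 1)"
      using step by (simp add: binary_upd)
    ultimately show ?thesis
      using True eq T N by (simp add: cliffify_body_def Let_def gap_Suc)
  next
    case False
    have "?T (Suc m) = ?T m"
    proof (intro ext)
      fix r j
      show "?T (Suc m) r j = ?T m r j"
        using False step N by (cases "j = m") (auto simp: transfer_def N_def)
    qed
    then show ?thesis
      using False T step N by (simp add: cliffify_body_def Let_def gap_Suc)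
  qed
  have "rev [m..<k] = rev [Suc m..<k] @ [m]"
    using step by (simp add: upt_conv_Cons)
  then show ?case using step body by simp
qed

text \<open>
  With \<open>M\<close> the running maximum, untangling replaces \<open>gap\<close> by \<open>gap - 2 * M\<close>. Hence the state \<open>(cur, d)\<close>
  of the untangling loop corresponds to the state \<open>(2 * d - cur, d)\<close> of the cliffifying loop.
\<close>

lemma untangle_body_inverse:
  assumes "binary B" "c \<le> d" "untangle_body i j (B, c, d) = (B', c', d')"
  shows "cliffify_body i j (B', 2 * d' - c', d') = (B, 2 * d - c, d)"
proof -
  have ab: "B i j = 0 \<or> B i j = 1" "B (Suc i) j = 0 \<or> B (Suc i) j = 1"
    using assms(1) by (auto simp: binary_def)
  show ?thesis
  proof (cases "c + B (Suc i) j - B i j > d")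
    case True
    then have eq: "B i j = 0" "B (Suc i) j = 1" "c = d" using ab assms(2) by auto
    have B': "B' = upd (upd B i j 1) (Suc i) j 0" "c' = d + 1" "d' = d + 1"
      using assms(3) True eq by (auto simp: untangle_body_def Let_def)
    have "upd (upd B' i j 0) (Suc i) j 1 = B"
      using eq by (auto simp: B' upd_def fun_eq_iff)
    then show ?thesis using eq by (simp add: cliffify_body_def Let_def B' upd_def)
  next
    case False
    then show ?thesis using assms by (auto simp: untangle_body_def cliffify_body_def Let_def)
  qed
qed

lemma cliffify_body_inverse:
  assumes "binary B" "d \<le> c" "cliffify_body i j (B, c, d) = (B', c', d')"
  shows "untangle_body i j (B', 2 * d' - c', d') = (B, 2 * d - c, d)"
    and "d' \<le> c'" and "binary B'"
proof -
  have ab: "B i j = 0 \<or> B i j = 1" "B (Suc i) j = 0 \<or> B (Suc i) j = 1"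
    using assms(1) by (auto simp: binary_def)
  have "untangle_body i j (B', 2 * d' - c', d') = (B, 2 * d - c, d) \<and> d' \<le> c' \<and> binary B'"
  proof (cases "c + B (Suc i) j - B i j < d")
    case True
    then have eq: "B i j = 1" "B (Suc i) j = 0" "c = d" using ab assms(2) by auto
    have B': "B' = upd (upd B i j 0) (Suc i) j 1" "c' = d - 1" "d' = d - 1"
      using assms(3) True eq by (auto simp: cliffify_body_def Let_def)
    have "upd (upd B' i j 1) (Suc i) j 0 = B"
      using eq by (auto simp: B' upd_def fun_eq_iff)
    then show ?thesis using eq assms(1)
      by (simp add: untangle_body_def Let_def B' binary_upd) (simp add: upd_def)
  next
    case False
    then show ?thesis using assms by (auto simp: untangle_body_def cliffify_body_def Let_def)
  qed
  then show "untangle_body i j (B', 2 * d' - c', d') = (B, 2 * d - c, d)" "d' \<le> c'" "binary B'"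
    by auto
qed

text \<open>Induction peels off the column that untangling visits last and cliffifying first. The
  inequality needed for one column holds because a running maximum dominates the current
  gap.\<close>

lemma untangle_loop_inverse:
  assumes "binary B" "fold (untangle_body i) [0..<k] (B, 0, 0) = (B', c, d)"
  shows "fold (cliffify_body i) (rev [0..<k]) (B', 2 * d - c, d) = (B, 0, 0)"
  using assms(2)
proof (induction k arbitrary: B' c d)
  case (Suc k)
  obtain B1 c1 d1 where 1: "fold (untangle_body i) [0..<k] (B, 0, 0) = (B1, c1, d1)"
    by (metis prod_cases3)
  have "binary B1" "c1 \<le> d1"
    using untangle_loop[OF assms(1), of i k] 1 gap_le_max_gap[of k k B i] by auto
  moreover have "untangle_body i k (B1, c1, d1) = (B', c, d)" using Suc.prems 1 by simp
  ultimately have "cliffify_body i k (B', 2 * d - c, d) = (B1, 2 * d1 - c1, d1)"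
    by (rule untangle_body_inverse)
  then show ?case using Suc.IH[OF 1] by simp
qed simp

text \<open>Here the column peeled off is visited first, so the induction runs over all starting
  states with \<open>d \<le> c\<close>; \<open>cliffify_body_inverse\<close> preserves this
  inequality.\<close>

lemma cliffify_loop_inverse:
  assumes "binary B" "d \<le> c" "fold (cliffify_body i) (rev [0..<k]) (B, c, d) = (B', c', d')"
  shows "fold (untangle_body i) [0..<k] (B', 2 * d' - c', d') = (B, 2 * d - c, d)"
  using assms
proof (induction k arbitrary: B c d)
  case (Suc k)
  obtain B1 c1 d1 where 1: "cliffify_body i k (B, c, d) = (B1, c1, d1)"
    by (metis prod_cases3)
  note inv = cliffify_body_inverse[OF Suc.prems(1,2) 1]
  have "fold (cliffify_body i) (rev [0..<k]) (B1, c1, d1) = (B', c', d')"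
    using Suc.prems(3) 1 by simp
  from Suc.IH[OF inv(3,2) this] show ?case using inv(1) by simp
qed simp


lemma upd_apply: "upd A r j x r' j' = (if r' = r \<and> j' = j then x else A r' j')"
  by (simp add: upd_def)

lemma psum_upd:
  "psum (upd A r j x) r' t = psum A r' t + (if r' = r \<and> j < t then x - A r j else 0)"
  by (induction t) (auto simp: psum_Suc upd_def less_Suc_eq)

lemma untangle_eq:
  assumes "binary B"
  shows "untangle i k (B, D) =
    (transfer i {..<k} (max_gap B i) B,
     upd (upd D i k (D i k - max_gap B i k)) (Suc i) k (max_gap B i k))"
  using untangle_loop[OF assms, of i k] by (simp add: untangle_def)

text \<open>Cliffifying, with the initial value of \<open>cur\<close> computed from \<open>B\<close> instead of \<open>h\<close>.\<close>

definition entangle :: "nat \<Rightarrow> nat \<Rightarrow> matrix \<times> matrix \<Rightarrow> matrix \<times> matrix" where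
  "entangle i k = (\<lambda>(B, D).
     (fst (fold (cliffify_body i) (rev [0..<k]) (B, - gap B i k, D (Suc i) k)),
      upd (upd D (Suc i) k 0) i k (D i k + D (Suc i) k)))"

lemma entangle_eq:
  assumes "binary B" "D (Suc i) k \<le> - gap B i k"
  shows "entangle i k (B, D) =
    (transfer i {..<k} (\<lambda>t. - min_gap B i k (D (Suc i) k) t) B,
     upd (upd D i k (D i k + D (Suc i) k)) (Suc i) k 0)"
  using cliffify_loop[OF assms, of 0]
  by (simp add: entangle_def atLeast0LessThan) (simp add: upd_def fun_eq_iff)

section \<open>The invariant\<close>

text \<open>
  State of combing in round \<open>k\<close> before the untangling of rows \<open>i\<close> and \<open>i + 1\<close>. From the fifth conjunct on:
  path \<open>r\<close> descends \<open>r\<close> rows in total; in the finished columns path \<open>r\<close> stays strictly below path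
  \<open>r + 1\<close>; so it does to the left of column \<open>k\<close>, except for the current pair. The last two
  conjuncts bound the violation at the current pair by the minimum \<open>N\<close> that would undo the preceding
  untangling: this is what makes the pair of rows \<open>(i - 1, i)\<close> stay in order when row \<open>i\<close> grows
  again. The case \<open>i = n\<close> describes the end of the round.
\<close>

definition comb_inv :: "nat \<Rightarrow> nat \<Rightarrow> nat \<Rightarrow> matrix \<Rightarrow> matrix \<Rightarrow> bool" where
  "comb_inv n k i B D \<longleftrightarrow>
     binary B \<and> (\<forall>r j. B r j \<noteq> 0 \<longrightarrow> j < r \<and> r < n) \<and>
     (\<forall>r j. 0 \<le> D r j) \<and>
     (\<forall>r j. D r j \<noteq> 0 \<longrightarrow> k \<le> j \<and> j \<le> r \<and> r < n \<and> (j = k \<longrightarrow> r \<le> i)) \<and>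
     (\<forall>r. k \<le> r \<and> r < n \<longrightarrow> psum B r (Suc r) + psum D r (Suc r) = int r) \<and>
     (\<forall>r j. k \<le> j \<and> j \<le> r \<and> Suc r < n \<and> (j = k \<longrightarrow> r < i) \<longrightarrow>
        gap B r j + gap D r j + D (Suc r) j \<le> 0) \<and>
     (\<forall>r t. k \<le> r \<and> Suc r < n \<and> t \<le> k \<and> r \<noteq> i \<longrightarrow> gap B r t \<le> 0) \<and>
     (\<forall>t. Suc i < n \<and> t \<le> k \<longrightarrow> gap B i t \<le> D i k) \<and>
     (\<forall>i' s t. i = Suc i' \<and> k \<le> i' \<and> Suc i < n \<and> s \<le> t \<and> t \<le> k \<longrightarrow> gap B i s \<le> - gap B i' t)"

section \<open>The effect of one transfer on totals and gaps, shared by both operations\<close>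

context
  fixes n k i :: nat and B D :: matrix and M :: "nat \<Rightarrow> int" and B' D' :: matrix
  assumes ik: "k \<le> i" "Suc i < n" and M0: "M 0 = 0"
  defines "B' \<equiv> transfer i {..<k} M B"
    and "D' \<equiv> upd (upd D i k (D i k - M k)) (Suc i) k (D (Suc i) k + M k)"
begin

text \<open>Row \<open>i\<close> gains \<open>M k\<close> in \<open>B\<close> to the left of column
  \<open>k\<close> and loses it in column \<open>k\<close> of \<open>D\<close>; row
  \<open>i + 1\<close> does the opposite. Hence the finished columns are not displaced.\<close>

lemma moved_total:
  assumes "k < t"
  shows "psum B' r t + psum D' r t = psum B r t + psum D r t"
proof -
  have "psum B' r t = psum B r t" if "r \<noteq> i" "r \<noteq> Suc i"
    using that by (intro psum_other_row) (simp add: B'_def)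
  then show ?thesis
    using assms by (cases "r = i"; cases "r = Suc i")
     (simp_all add: B'_def D'_def psum_upd upd_apply psum_transfer_total M0)
qed

lemma moved_total_gap: "k < t \<Longrightarrow> gap B' r t + gap D' r t = gap B r t + gap D r t"
  using moved_total[of t r] moved_total[of t "Suc r"] by (simp add: gap_def)

lemma moved_D: "j \<noteq> k \<or> r \<noteq> i \<and> r \<noteq> Suc i \<Longrightarrow> D' r j = D r j"
  and moved_D_i: "D' i k = D i k - M k"
  and moved_D_Suc_i: "D' (Suc i) k = D (Suc i) k + M k"
  by (auto simp: D'_def upd_def)

lemma moved_gap_D: "gap D' r k = gap D r k"
  by (simp add: D'_def gap_def psum_upd)

lemma moved_gap:
  assumes "t \<le> k"
  shows "gap B' i t = gap B i t - 2 * M t"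
    and "gap B' (Suc i) t = gap B (Suc i) t + M t"
    and "i = Suc i' \<Longrightarrow> gap B' i' t = gap B i' t + M t"
    and "r \<noteq> i \<Longrightarrow> r \<noteq> Suc i \<Longrightarrow> Suc r \<noteq> i \<Longrightarrow> gap B' r t = gap B r t"
proof -
  have *: "psum B' r t = psum B r t" if "r \<noteq> i" "r \<noteq> Suc i" for r
    using that by (intro psum_other_row) (simp add: B'_def)
  note ps = psum_transfer[OF assms, of i M B, folded B'_def]
  show "gap B' i t = gap B i t - 2 * M t"
    using ps by (simp add: gap_def M0)
  show "gap B' (Suc i) t = gap B (Suc i) t + M t"
    using ps *[of "Suc (Suc i)"] by (simp add: gap_def M0)
  show "i = Suc i' \<Longrightarrow> gap B' i' t = gap B i' t + M t"
    using ps *[of i'] by (simp add: gap_def M0)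
  show "r \<noteq> i \<Longrightarrow> r \<noteq> Suc i \<Longrightarrow> Suc r \<noteq> i \<Longrightarrow> gap B' r t = gap B r t"
    using *[of r] *[of "Suc r"] by (simp add: gap_def)
qed

lemma moved_support:
  assumes "\<And>r j. B r j \<noteq> 0 \<Longrightarrow> j < r \<and> r < n" and "B' r j \<noteq> 0"
  shows "j < r \<and> r < n"
proof -
  have "B r j \<noteq> 0 \<or> j < k \<and> (r = i \<or> r = Suc i)"
    using assms(2) by (auto simp: B'_def transfer_def split: if_splits)
  then show ?thesis using assms(1) ik by auto
qed

end

section \<open>Invariance under one untangling and under its inverse\<close>

lemma comb_invD:
  assumes "comb_inv n k i B D"
  shows "binary B"
    and "B r j \<noteq> 0 \<Longrightarrow> j < r \<and> r < n"
    and "0 \<le> D r j"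
    and "D r j \<noteq> 0 \<Longrightarrow> k \<le> j \<and> j \<le> r \<and> r < n \<and> (j = k \<longrightarrow> r \<le> i)"
    and "k \<le> r \<Longrightarrow> r < n \<Longrightarrow> psum B r (Suc r) + psum D r (Suc r) = int r"
    and "k \<le> j \<Longrightarrow> j \<le> r \<Longrightarrow> Suc r < n \<Longrightarrow> (j = k \<longrightarrow> r < i) \<Longrightarrow>
        gap B r j + gap D r j + D (Suc r) j \<le> 0"
    and "k \<le> r \<Longrightarrow> Suc r < n \<Longrightarrow> t \<le> k \<Longrightarrow> r \<noteq> i \<Longrightarrow> gap B r t \<le> 0"
    and "Suc i < n \<Longrightarrow> t \<le> k \<Longrightarrow> gap B i t \<le> D i k"
    and "i = Suc i' \<Longrightarrow> k \<le> i' \<Longrightarrow> Suc i < n \<Longrightarrow> s \<le> t \<Longrightarrow> t \<le> k \<Longrightarrow> gap B i s \<le> - gap B i' t"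
  using assms unfolding comb_inv_def by (elim conjE, simp)+

lemma comb_inv_psum_D:
  assumes "comb_inv n k i B D" "t \<le> k"
  shows "psum D r t = 0"
  unfolding psum_def
proof (rule sum.neutral, rule ballI, rule ccontr)
  fix j assume "j \<in> {..<t}" "D r j \<noteq> 0"
  then show False using comb_invD(4)[OF assms(1), of r j] assms(2) by simp
qed

lemma comb_inv_gap_D: "comb_inv n k i B D \<Longrightarrow> t \<le> k \<Longrightarrow> gap D r t = 0"
  by (simp add: gap_def comb_inv_psum_D)

text \<open>With \<open>M\<close> the running maximum, the gaps of the pairs
  \<open>(i - 1, i)\<close>, \<open>(i, i + 1)\<close>, \<open>(i + 1, i + 2)\<close> change by
  \<open>M\<close>, \<open>- 2 * M\<close> and \<open>M\<close>. The second becomes at most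
  \<open>0\<close>, the first change is absorbed by the last conjunct of the invariant, and the
  third may create a new violation, bounded by the new entry \<open>M k\<close> of
  \<open>D\<close>.\<close>

lemma comb_inv_untangle:
  assumes inv: "comb_inv n k i B D" and ik: "k \<le> i" "Suc i < n"
    and eq: "untangle i k (B, D) = (B', D')"
  shows "comb_inv n k (Suc i) B' D'"
proof -
  note bin = comb_invD(1)[OF inv] and supp = comb_invD(2)[OF inv]
    and D0 = comb_invD(3)[OF inv] and Ds = comb_invD(4)[OF inv] and tot = comb_invD(5)[OF inv]
    and dis = comb_invD(6)[OF inv] and dom = comb_invD(7)[OF inv]
    and domi = comb_invD(8)[OF inv ik(2)] and prev = comb_invD(9)[OF inv _ _ ik(2)]
  define M where "M = max_gap B i"
  have M0: "M 0 = 0" and Mge: "\<And>t. gap B i t \<le> M t" and Mpos: "\<And>t. 0 \<le> M t"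
    and Mmono: "\<And>s t. s \<le> t \<Longrightarrow> M s \<le> M t"
    and Mle: "\<And>t x. (\<And>s. s \<le> t \<Longrightarrow> gap B i s \<le> x) \<Longrightarrow> M t \<le> x"
    by (auto simp: M_def gap_le_max_gap max_gap_nonneg max_gap_mono max_gap_le_iff)
  \<comment> \<open>Untangling assigns this entry, whereas \<open>D'\<close> below adds to it; the
    two agree because column \<open>k\<close> is still empty in the rows beyond
    \<open>i\<close>.\<close>
  have Dz: "D (Suc i) k = 0" using Ds[of "Suc i" k] by auto
  have B': "B' = transfer i {..<k} M B"
    and D': "D' = upd (upd D i k (D i k - M k)) (Suc i) k (D (Suc i) k + M k)"
    using eq untangle_eq[OF bin, of i k D] by (auto simp: M_def Dz)
  note moved = moved_total[where M = M, OF ik M0, where B = B and D = D, folded B' D']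
    and moved_total_gap = moved_total_gap[where M = M, OF ik M0, where B = B and D = D, folded B' D']
    and moved_D = moved_D[where M = M, OF ik M0, where D = D, folded D']
    and moved_D_i = moved_D_i[where M = M, OF ik M0, where D = D, folded D']
    and moved_D_Suc_i = moved_D_Suc_i[where M = M, OF ik M0, where D = D, folded D']
    and moved_gap_D = moved_gap_D[where M = M, OF ik M0, where D = D, folded D']
    and moved_gap = moved_gap[where M = M, OF ik M0, where B = B, folded B']
  \<comment> \<open>The bound on the current pair ensures that row \<open>i\<close> has enough
    vertical steps in column \<open>k\<close> to give away.\<close>
  have Mk: "M k \<le> D i k" using domi by (intro Mle) auto
  show ?thesis
    unfolding comb_inv_def
  proof (intro conjI allI impI)
    show "binary B'" using untangle_loop[OF bin, of i k] by (simp add: B' M_def)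
  next
    fix r j assume "B' r j \<noteq> 0"
    then show "j < r" "r < n"
      using moved_support[where M = M and B = B and r = r and j = j, OF ik M0 supp, folded B']
      by blast+
  next
    fix r j show "0 \<le> D' r j"
      using D0[of r j] Mk Mpos[of k] moved_D[of j r] moved_D_i moved_D_Suc_i Dz
      by (cases "j = k"; cases "r = i"; cases "r = Suc i") auto
  next
    fix r j assume "D' r j \<noteq> 0"
    then show "k \<le> j" "j \<le> r" "r < n" "j = k \<Longrightarrow> r \<le> Suc i"
      using Ds[of r j] moved_D[of j r] ik
      by (cases "j = k"; cases "r = i"; cases "r = Suc i"; force)+
  next
    fix r assume "k \<le> r \<and> r < n"
    then show "psum B' r (Suc r) + psum D' r (Suc r) = int r"
      using tot moved[of "Suc r" r] by auto
  next
    fix r j assume r: "k \<le> j \<and> j \<le> r \<and> Suc r < n \<and> (j = k \<longrightarrow> r < Suc i)"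
    show "gap B' r j + gap D' r j + D' (Suc r) j \<le> 0"
    proof (cases "j = k")
      case False
      then show ?thesis using dis[of j r] moved_total_gap[of j r] moved_D[of j "Suc r"] r by auto
    next
      case True
      have "gap D r k = 0" "gap B i k \<le> M k"
        using inv by (simp_all add: comb_inv_gap_D Mge)
      note facts = this True r dis[of k r] moved_gap_D[of r] Dz
      \<comment> \<open>In column \<open>k\<close> the pair \<open>(i, i + 1)\<close> ends with
        \<open>gap B i k - 2 * M k + M k\<close>; for \<open>(i - 1, i)\<close> the changes of the
        gap and of \<open>D i k\<close> cancel.\<close>
      consider "r = i" | "Suc r = i" | "Suc r < i" using r True by linarith
      then show ?thesis
      proof cases
        case 1
        then show ?thesis using facts moved_gap(1)[of k] moved_D_Suc_i by simp
      next
        case 2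
        then show ?thesis using facts moved_gap(3)[of k r] moved_D_i by simp
      next
        case 3
        then show ?thesis using facts moved_gap(4)[of k r] moved_D[of k "Suc r"] by simp
      qed
    qed
  next
    fix r t assume r: "k \<le> r \<and> Suc r < n \<and> t \<le> k \<and> r \<noteq> Suc i"
    consider "r = i" | "Suc r = i" | "r \<noteq> i" "Suc r \<noteq> i" by blast
    then show "gap B' r t \<le> 0"
    proof cases
      case 1
      then show ?thesis using moved_gap(1)[of t] Mge[of t] Mpos[of t] r by auto
    next
      case 2
      \<comment> \<open>The last conjunct compares all gaps at \<open>i\<close> up to
        \<open>t\<close> with the gap at \<open>r\<close>, hence also their maximum.\<close>
      have "M t \<le> - gap B r t" using prev[of r _ t] 2 r by (intro Mle) auto
      then show ?thesis using moved_gap(3)[of t r] 2 r by auto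
    next
      case 3
      then show ?thesis using moved_gap(4)[of t r] dom[of r t] r by auto
    qed
  next
    fix t assume t: "Suc (Suc i) < n \<and> t \<le> k"
    then show "gap B' (Suc i) t \<le> D' (Suc i) k"
      using moved_gap(2)[of t] dom[of "Suc i" t] Mmono[of t k] moved_D_Suc_i Dz ik by auto
  next
    fix i' s t assume *: "Suc i = Suc i' \<and> k \<le> i' \<and> Suc (Suc i) < n \<and> s \<le> t \<and> t \<le> k"
    \<comment> \<open>Here
      \<open>gap B (Suc i) s + M s \<le> M t \<le> 2 * M t - gap B i t\<close>.\<close>
    then show "gap B' (Suc i) s \<le> - gap B' i' t"
      using moved_gap(2)[of s] dom[of "Suc i" s] Mmono[of s t] moved_gap(1)[of t] Mge[of t] ik by auto
  qed
qed

text \<open>The order of paths \<open>i\<close> and \<open>i + 1\<close> in column \<open>k\<close>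
  bounds \<open>d\<close> as the loop requires, and the order of their prefixes makes
  \<open>N\<close> nonnegative. So the loop ends in \<open>(B', 0, 0)\<close>, the start of
  untangling. If there is a row \<open>i + 2\<close>, the last two conjuncts of the invariant say
  that \<open>gap B (Suc i)\<close> is at most \<open>N\<close>, so that pair is in order
  again.\<close>

lemma comb_inv_entangle:
  assumes inv: "comb_inv n k (Suc i) B D" and ik: "k \<le> i" "Suc i < n"
    and eq: "entangle i k (B, D) = (B', D')"
  shows "comb_inv n k i B' D'" and "untangle i k (B', D') = (B, D)"
    and "psum B' i k = psum B i k - D (Suc i) k"
    and "psum B' (Suc i) k = psum B (Suc i) k + D (Suc i) k"
    and "\<And>r. r \<noteq> i \<Longrightarrow> r \<noteq> Suc i \<Longrightarrow> B' r = B r"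
proof -
  note bin = comb_invD(1)[OF inv] and supp = comb_invD(2)[OF inv]
    and D0 = comb_invD(3)[OF inv] and Ds = comb_invD(4)[OF inv] and tot = comb_invD(5)[OF inv]
    and dis = comb_invD(6)[OF inv] and dom = comb_invD(7)[OF inv]
    and domi = comb_invD(8)[OF inv] and prev = comb_invD(9)[OF inv refl ik(1)]
  define d where "d = D (Suc i) k"
  have gapDk: "gap D r k = 0" for r
    using inv by (simp add: comb_inv_gap_D)
  have d0: "0 \<le> d" and dk: "d \<le> - gap B i k"
    using D0 dis[of k i] gapDk[of i] ik by (auto simp: d_def)
  define N where "N = min_gap B i k d"
  have Nge: "\<And>x t. x \<le> d \<Longrightarrow> (\<And>s. t \<le> s \<Longrightarrow> s \<le> k \<Longrightarrow> x \<le> - gap B i s) \<Longrightarrow> x \<le> N t"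
    and Nle: "\<And>t. t \<le> k \<Longrightarrow> N t \<le> - gap B i t" and Nd: "\<And>t. N t \<le> d"
    and Nmono: "\<And>s t. s \<le> t \<Longrightarrow> N s \<le> N t" and Nk: "N k = d"
    using dk by (auto simp: N_def le_min_gap_iff min_gap_le min_gap_le_bound min_gap_mono min_gap_last)
  have Npos: "0 \<le> N t" for t
    using d0 dom[of i] ik by (intro Nge) auto
  \<comment> \<open>The gap at \<open>0\<close> vanishes, so the minimum cannot stay positive there:
    the whole of \<open>d\<close> gets moved.\<close>
  have N0: "N 0 = 0" using Npos[of 0] Nle[of 0] by simp
  define M where "M = (\<lambda>t. - N t)"
  have M0: "M 0 = 0" by (simp add: M_def N0)
  have B': "B' = transfer i {..<k} M B"
    and D': "D' = upd (upd D i k (D i k - M k)) (Suc i) k (D (Suc i) k + M k)"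
    using eq entangle_eq[of B D i k] bin dk by (auto simp: M_def N_def[symmetric] d_def[symmetric] Nk)
  note moved = moved_total[where M = M, OF ik M0, where B = B and D = D, folded B' D']
    and moved_total_gap = moved_total_gap[where M = M, OF ik M0, where B = B and D = D, folded B' D']
    and moved_D = moved_D[where M = M, OF ik M0, where D = D, folded D']
    and moved_D_i = moved_D_i[where M = M, OF ik M0, where D = D, folded D']
    and moved_D_Suc_i = moved_D_Suc_i[where M = M, OF ik M0, where D = D, folded D']
    and moved_gap_D = moved_gap_D[where M = M, OF ik M0, where D = D, folded D']
    and moved_gap = moved_gap[where M = M, OF ik M0, where B = B, folded B']
  have D'i: "D' i k = D i k + d" "D' (Suc i) k = 0"
    using moved_D_i moved_D_Suc_i by (simp_all add: M_def Nk d_def)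
  have loop: "fold (cliffify_body i) (rev [0..<k]) (B, - gap B i k, d) = (B', 0, 0)" and bin': "binary B'"
    using cliffify_loop[OF bin dk, of 0] N0 by (simp_all add: B' M_def N_def atLeast0LessThan)
  have "fold (untangle_body i) [0..<k] (B', 0, 0) = (B, 2 * d + gap B i k, d)"
    using cliffify_loop_inverse[OF bin dk loop] by simp
  then show "untangle i k (B', D') = (B, D)"
    using D'i moved_D by (auto simp: untangle_def upd_def fun_eq_iff d_def)
  show "psum B' i k = psum B i k - D (Suc i) k" "psum B' (Suc i) k = psum B (Suc i) k + D (Suc i) k"
    using Nk N0 by (simp_all add: B' psum_transfer M_def d_def)
  show "B' r = B r" if "r \<noteq> i" "r \<noteq> Suc i" for r using that by (simp add: B')
  show "comb_inv n k i B' D'"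
    unfolding comb_inv_def
  proof (intro conjI allI impI)
    show "binary B'" by (rule bin')
  next
    fix r j assume "B' r j \<noteq> 0"
    then show "j < r" "r < n"
      using moved_support[where M = M and B = B and r = r and j = j, OF ik M0 supp, folded B']
      by blast+
  next
    fix r j show "0 \<le> D' r j"
      using D0[of r j] D'i d0 moved_D[of j r]
      by (cases "j = k"; cases "r = i"; cases "r = Suc i") auto
  next
    fix r j assume "D' r j \<noteq> 0"
    then show "k \<le> j" "j \<le> r" "r < n" "j = k \<Longrightarrow> r \<le> i"
      using Ds[of r j] moved_D[of j r] ik D'i
      by (cases "j = k"; cases "r = i"; cases "r = Suc i"; force)+
  next
    fix r assume "k \<le> r \<and> r < n"
    then show "psum B' r (Suc r) + psum D' r (Suc r) = int r"
      using tot moved[of "Suc r" r] by auto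
  next
    fix r j assume r: "k \<le> j \<and> j \<le> r \<and> Suc r < n \<and> (j = k \<longrightarrow> r < i)"
    show "gap B' r j + gap D' r j + D' (Suc r) j \<le> 0"
    proof (cases "j = k")
      case False
      then show ?thesis using dis[of j r] moved_total_gap[of j r] moved_D[of j "Suc r"] r by auto
    next
      case True
      consider "Suc r = i" | "Suc r < i" using r True by linarith
      then show ?thesis
        using True r dis[of k r] moved_gap(1)[of k] moved_gap(3,4)[of k r] moved_gap_D[of r] D'i moved_D[of k "Suc r"] Nk
        by cases (auto simp: M_def)
    qed
  next
    fix r t assume r: "k \<le> r \<and> Suc r < n \<and> t \<le> k \<and> r \<noteq> i"
    consider "r = Suc i" | "Suc r = i" | "r \<noteq> Suc i" "Suc r \<noteq> i" by blast
    then show "gap B' r t \<le> 0"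
    proof cases
      case 1
      have "gap B (Suc i) t \<le> N t"
        using 1 r by (intro Nge) (auto simp: d_def intro: domi prev)
      then show ?thesis using moved_gap(2)[of t] 1 r by (auto simp: M_def)
    next
      case 2
      then show ?thesis using moved_gap(3)[of t r] dom[of r t] Npos[of t] r by (auto simp: M_def)
    next
      case 3
      then show ?thesis using moved_gap(4)[of t r] dom[of r t] r by auto
    qed
  next
    fix t assume t: "Suc i < n \<and> t \<le> k"
    then show "gap B' i t \<le> D' i k"
      using moved_gap(1)[of t] Nle[of t] Nd[of t] D'i D0[of i k] by (auto simp: M_def)
  next
    fix i' s t assume *: "i = Suc i' \<and> k \<le> i' \<and> Suc i < n \<and> s \<le> t \<and> t \<le> k"
    \<comment> \<open>Here \<open>gap B i s + 2 * N s \<le> N s \<le> N t \<le> N t - gap B i'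
      t\<close>.\<close>
    then show "gap B' i s \<le> - gap B' i' t"
      using moved_gap(1)[of s] Nle[of s] Nmono[of s t] moved_gap(3)[of t i'] dom[of i' t]
      by (auto simp: M_def)
  qed
qed

text \<open>The result determines the final state of the loop: \<open>d\<close> stands in row
  \<open>i + 1\<close> of \<open>D\<close>, and \<open>2 * d - cur\<close> is the negated gap of the
  new matrix. From there both loops run back to their inputs, and the vanishing of the overwritten
  entries restores \<open>D\<close> and \<open>E\<close>.\<close>

lemma untangle_inj:
  assumes "binary B" "binary C" "D (Suc i) k = 0" "E (Suc i) k = 0"
    and eq: "untangle i k (B, D) = untangle i k (C, E)"
  shows "B = C \<and> D = E"
proof -
  obtain B' c d where 1: "fold (untangle_body i) [0..<k] (B, 0, 0) = (B', c, d)"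
    by (metis prod_cases3)
  obtain C' c' d' where 2: "fold (untangle_body i) [0..<k] (C, 0, 0) = (C', c', d')"
    by (metis prod_cases3)
  have D: "untangle i k (B, D) = (B', upd (upd D i k (D i k - d)) (Suc i) k d)"
    by (simp add: untangle_def 1)
  have E: "untangle i k (C, E) = (C', upd (upd E i k (E i k - d')) (Suc i) k d')"
    by (simp add: untangle_def 2)
  have same: "B' = C'" and upd_eq: "upd (upd D i k (D i k - d)) (Suc i) k d r j =
      upd (upd E i k (E i k - d')) (Suc i) k d' r j" for r j
    using eq D E by auto
  have d: "d = d'" using upd_eq[of "Suc i" k] by (simp add: upd_apply)
  have "D r j = E r j" for r j
    using upd_eq[of r j] assms(3,4) d by (auto simp: upd_apply split: if_splits)
  moreover have "2 * d - c = 2 * d' - c'"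
  proof -
    have "2 * d - c = - gap B' i k" if "binary B" "fold (untangle_body i) [0..<k] (B, 0, 0) = (B', c, d)" for B B' c d
      using untangle_loop[OF that(1), of i k] that(2) by (auto simp: gap_def psum_transfer)
    from this[OF assms(1) 1] this[OF assms(2) 2] same show ?thesis by simp
  qed
  ultimately show ?thesis
    using untangle_loop_inverse[OF assms(1) 1] untangle_loop_inverse[OF assms(2) 2] same d by auto
qed


section \<open>The outer loops\<close>

lemma psum_le: "binary B \<Longrightarrow> s \<le> t \<Longrightarrow> psum B r t \<le> psum B r s + (int t - int s)"
proof -
  assume B: "binary B" and "s \<le> t"
  from \<open>s \<le> t\<close> show ?thesis
  proof (induction rule: dec_induct)
    case (step t)
    then show ?case using binaryD[OF B, of r t] by (auto simp: psum_Suc)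
  qed simp
qed

text \<open>The last untangling leaves the index \<open>n - 1\<close>. Neither \<open>n - 1\<close>
  nor \<open>n\<close> has a next row, so all conditions on a current pair are vacuous and the
  others range over the same rows.\<close>

lemma comb_inv_last:
  assumes "k < n"
  shows "comb_inv n k (n - 1) B D \<longleftrightarrow> comb_inv n k n B D"
proof -
  obtain m where n: "n = Suc m" using assms by (cases n) auto
  have 1: "r < n \<and> (j = k \<longrightarrow> r \<le> m) \<longleftrightarrow> r < n \<and> (j = k \<longrightarrow> r \<le> n)" for r j
    using n by auto
  have 2: "Suc r < n \<and> (j = k \<longrightarrow> r < m) \<longleftrightarrow> Suc r < n \<and> (j = k \<longrightarrow> r < n)" for r j
    using n by auto
  have 3: "Suc r < n \<and> t \<le> k \<and> r \<noteq> m \<longleftrightarrow> Suc r < n \<and> t \<le> k \<and> r \<noteq> n" for r t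
    using n by auto
  have 4: "\<not> Suc m < n" "\<not> Suc n < n" "n - 1 = m" using n by auto
  show ?thesis unfolding comb_inv_def 4(3) 1 2 3 using 4(1,2) by simp
qed

text \<open>The new entry makes row \<open>k\<close> descend by exactly \<open>k\<close>. Nothing is
  known about the order of rows \<open>k\<close> and \<open>k + 1\<close>, but binary entries alone
  bound their gap by \<open>D k k\<close>.\<close>

lemma comb_inv_round_start:
  assumes inv: "comb_inv n (Suc k) n B D" and k: "k < n"
  shows "comb_inv n k k B (upd D k k (int k - (\<Sum>j<k. B k j)))"
proof -
  note bin = comb_invD(1)[OF inv] and supp = comb_invD(2)[OF inv]
    and D0 = comb_invD(3)[OF inv] and Ds = comb_invD(4)[OF inv] and tot = comb_invD(5)[OF inv]
    and dis = comb_invD(6)[OF inv] and dom = comb_invD(7)[OF inv]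
  let ?D = "upd D k k (int k - psum B k k)"
  have Dkk: "D k k = 0" using Ds[of k k] by auto
  have Bkk: "B k k = 0" using supp[of k k] by auto
  have pk: "psum B k k \<le> int k" using psum_le[OF bin, of 0 k k] by simp
  have pD: "psum D k (Suc k) = 0" using inv by (simp add: comb_inv_psum_D)
  have gapD: "gap ?D r j = gap D r j" if "k < r" for r j
    using that by (simp add: gap_def psum_upd)
  have "comb_inv n k k B ?D"
    unfolding comb_inv_def
  proof (intro conjI allI impI)
    fix r j assume "?D r j \<noteq> 0"
    then show "k \<le> j" "j \<le> r" "r < n" "j = k \<Longrightarrow> r \<le> k"
      using Ds[of r j] k by (auto simp: upd_apply split: if_splits)
  next
    fix r assume r: "k \<le> r \<and> r < n"
    show "psum B r (Suc r) + psum ?D r (Suc r) = int r"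
    proof (cases "r = k")
      case True
      then show ?thesis using pD Dkk Bkk by (simp add: psum_upd psum_Suc[of B])
    next
      case False
      then show ?thesis using tot[of r] r by (simp add: psum_upd)
    qed
  next
    fix r j assume "k \<le> j \<and> j \<le> r \<and> Suc r < n \<and> (j = k \<longrightarrow> r < k)"
    then show "gap B r j + gap ?D r j + ?D (Suc r) j \<le> 0"
      using dis[of j r] gapD[of r j] by (cases "j = k") (auto simp: upd_apply)
  next
    fix r t assume "k \<le> r \<and> Suc r < n \<and> t \<le> k \<and> r \<noteq> k"
    then show "gap B r t \<le> 0" using dom[of r t] by auto
  next
    fix t assume "Suc k < n \<and> t \<le> k"
    \<comment> \<open>Row \<open>k + 1\<close> has at most \<open>t\<close> ones in the first
      \<open>t\<close> columns, and row \<open>k\<close> has at most \<open>k - t\<close> ones in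
      columns \<open>t\<close> to \<open>k - 1\<close>.\<close>
    then show "gap B k t \<le> ?D k k"
      using psum_le[OF bin, of 0 t "Suc k"] psum_le[OF bin, of t k k] by (simp add: gap_def upd_apply)
  qed (use bin supp D0 pk in \<open>auto simp: upd_apply\<close>)
  then show ?thesis by (simp add: psum_def)
qed

text \<open>At \<open>i = k\<close> column \<open>k\<close> of \<open>D\<close> is empty outside row
  \<open>k\<close>, and the total of row \<open>k\<close> forces \<open>D k k\<close> to be the
  value that combing assigns. Clearing it gives a state between two rounds.\<close>

lemma comb_inv_round_finish:
  assumes inv: "comb_inv n k k B D" and k: "k < n"
  shows "comb_inv n (Suc k) n B (upd D k k 0)"
    and "D k k = int k - (\<Sum>j<k. B k j)"
proof -
  note bin = comb_invD(1)[OF inv] and supp = comb_invD(2)[OF inv]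
    and D0 = comb_invD(3)[OF inv] and Ds = comb_invD(4)[OF inv] and tot = comb_invD(5)[OF inv]
    and dis = comb_invD(6)[OF inv] and dom = comb_invD(7)[OF inv]
  let ?D = "upd D k k 0"
  have Bkk: "B k k = 0" using supp[of k k] by auto
  have pD: "psum D r k = 0" for r using inv by (simp add: comb_inv_psum_D)
  show "D k k = int k - (\<Sum>j<k. B k j)"
    using tot[of k] k pD Bkk by (simp add: psum_Suc) (simp add: psum_def)
  have gapD: "gap ?D r j = gap D r j" if "k < r" for r j
    using that by (simp add: gap_def psum_upd)
  have dis': "gap B r j + gap D r j + D (Suc r) j \<le> 0" if "Suc k \<le> j" "j \<le> r" "Suc r < n" for r j
    using dis[of j r] that by auto
  have col: "D r k = 0" if "k < r" for r using Ds[of r k] that by auto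
  show "comb_inv n (Suc k) n B ?D"
    unfolding comb_inv_def
  proof (intro conjI allI impI)
    fix r j assume "?D r j \<noteq> 0"
    then have "D r j \<noteq> 0" "(r, j) \<noteq> (k, k)" by (auto simp: upd_apply split: if_splits)
    then show "Suc k \<le> j" "j \<le> r" "r < n" "r \<le> n"
      using Ds[of r j] by (cases "j = k"; force)+
  next
    fix r assume "Suc k \<le> r \<and> r < n"
    then show "psum B r (Suc r) + psum ?D r (Suc r) = int r"
      using tot[of r] by (simp add: psum_upd)
  next
    fix r j assume "Suc k \<le> j \<and> j \<le> r \<and> Suc r < n \<and> (j = Suc k \<longrightarrow> r < n)"
    then show "gap B r j + gap ?D r j + ?D (Suc r) j \<le> 0"
      using dis'[of j r] gapD[of r j] by (auto simp: upd_apply)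
  next
    fix r t assume r: "Suc k \<le> r \<and> Suc r < n \<and> t \<le> Suc k \<and> r \<noteq> n"
    show "gap B r t \<le> 0"
    proof (cases "t \<le> k")
      case True
      then show ?thesis using dom[of r t] r by auto
    next
      case False
      \<comment> \<open>These rows have no vertical steps up to column \<open>k\<close>, so the
        order of the paths in column \<open>Suc k\<close> bounds the gap of the longer
        prefix.\<close>
      then have "t = Suc k" using r by auto
      moreover have "gap D r (Suc k) = 0" using r pD col by (simp add: gap_def psum_Suc)
      ultimately show ?thesis using dis'[of "Suc k" r] D0[of "Suc r" "Suc k"] r by auto
    qed
  qed (use bin supp D0 in \<open>auto simp: upd_apply\<close>)
qed

section \<open>Rounds of combing: invariance and injectivity\<close>

lemma comb_inv_untangle_loop:
  assumes "comb_inv n k k B D" "k \<le> m" "m < n"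
    and "fold (\<lambda>i. untangle i k) [k..<m] (B, D) = (B', D')"
  shows "comb_inv n k m B' D'"
  using assms(2-4)
proof (induction m arbitrary: B' D' rule: dec_induct)
  case base
  then show ?case using assms(1) by simp
next
  case (step m)
  obtain B1 D1 where 1: "fold (\<lambda>i. untangle i k) [k..<m] (B, D) = (B1, D1)"
    by (cases "fold (\<lambda>i. untangle i k) [k..<m] (B, D)") blast
  have "comb_inv n k m B1 D1" using step 1 by simp
  then show ?case
    by (rule comb_inv_untangle) (use step 1 in auto)
qed

lemma untangle_loop_inj:
  assumes "comb_inv n k k B D" "comb_inv n k k C E" "k \<le> m" "m < n"
    and "fold (\<lambda>i. untangle i k) [k..<m] (B, D) = fold (\<lambda>i. untangle i k) [k..<m] (C, E)"
  shows "B = C \<and> D = E"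
  using assms(3-5)
proof (induction m rule: dec_induct)
  case (step m)
  obtain B1 D1 where 1: "fold (\<lambda>i. untangle i k) [k..<m] (B, D) = (B1, D1)"
    by (cases "fold (\<lambda>i. untangle i k) [k..<m] (B, D)") blast
  obtain C1 E1 where 2: "fold (\<lambda>i. untangle i k) [k..<m] (C, E) = (C1, E1)"
    by (cases "fold (\<lambda>i. untangle i k) [k..<m] (C, E)") blast
  have i1: "comb_inv n k m B1 D1"
    by (rule comb_inv_untangle_loop[OF assms(1) _ _ 1]) (use step in auto)
  have i2: "comb_inv n k m C1 E1"
    by (rule comb_inv_untangle_loop[OF assms(2) _ _ 2]) (use step in auto)
  have "D1 (Suc m) k = 0" "E1 (Suc m) k = 0"
    using comb_invD(4)[OF i1, of "Suc m" k] comb_invD(4)[OF i2, of "Suc m" k] by auto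
  moreover have "untangle m k (B1, D1) = untangle m k (C1, E1)"
    using step.prems(2) step.hyps 1 2 by simp
  ultimately have "B1 = C1 \<and> D1 = E1"
    using untangle_inj comb_invD(1)[OF i1] comb_invD(1)[OF i2] by blast
  then show ?case using step 1 2 by simp
qed simp

definition comb_round :: "nat \<Rightarrow> nat \<Rightarrow> matrix \<times> matrix \<Rightarrow> matrix \<times> matrix" where
  "comb_round n k = (\<lambda>(B, D).
     fold (\<lambda>i. untangle i k) [k..<n - 1] (B, upd D k k (int k - (\<Sum>j<k. B k j))))"

lemma combing_eq: "combing n B = fold (comb_round n) (rev [0..<n]) (B, \<lambda>_ _. 0)"
  by (simp add: combing_def comb_round_def[abs_def])

lemma comb_inv_round:
  assumes "comb_inv n (Suc k) n B D" "k < n" "comb_round n k (B, D) = (B', D')"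
  shows "comb_inv n k n B' D'"
proof -
  have "comb_inv n k (n - 1) B' D'"
    by (rule comb_inv_untangle_loop[OF comb_inv_round_start[OF assms(1,2)]])
       (use assms in \<open>auto simp: comb_round_def\<close>)
  then show ?thesis using comb_inv_last[OF assms(2)] by blast
qed

lemma comb_round_inj:
  assumes "comb_inv n (Suc k) n B D" "comb_inv n (Suc k) n C E" "k < n"
    and eq: "comb_round n k (B, D) = comb_round n k (C, E)"
  shows "B = C \<and> D = E"
proof -
  have *: "B = C \<and> upd D k k (int k - (\<Sum>j<k. B k j)) = upd E k k (int k - (\<Sum>j<k. C k j))"
    by (rule untangle_loop_inj[OF comb_inv_round_start[OF assms(1,3)] comb_inv_round_start[OF assms(2,3)],
          where m = "n - 1"])
       (use assms(3) eq in \<open>auto simp: comb_round_def\<close>)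
  \<comment> \<open>The assignment hides the old diagonal entries; the invariant for
    \<open>Suc k\<close> makes both of them \<open>0\<close>.\<close>
  have "D k k = E k k"
    using comb_invD(4)[OF assms(1), of k k] comb_invD(4)[OF assms(2), of k k]
    by (cases "D k k = 0"; cases "E k k = 0") auto
  then have "D r j = E r j" for r j
    using * fun_cong[OF fun_cong[OF conjunct2[OF *]], of r j] by (auto simp: upd_apply split: if_splits)
  then show ?thesis using * by auto
qed

lemma comb_inv_rounds:
  assumes "comb_inv n m n B D" "m \<le> n" "fold (comb_round n) (rev [0..<m]) (B, D) = (B', D')"
  shows "comb_inv n 0 n B' D'"
  using assms
proof (induction m arbitrary: B D)
  case (Suc m)
  obtain B1 D1 where "comb_round n m (B, D) = (B1, D1)" by (cases "comb_round n m (B, D)") blast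
  then show ?case using Suc comb_inv_round[OF Suc.prems(1)] by auto
qed simp

lemma comb_rounds_inj:
  assumes "comb_inv n m n B D" "comb_inv n m n C E" "m \<le> n"
    and "fold (comb_round n) (rev [0..<m]) (B, D) = fold (comb_round n) (rev [0..<m]) (C, E)"
  shows "B = C \<and> D = E"
  using assms
proof (induction m arbitrary: B D C E)
  case (Suc m)
  obtain B1 D1 where 1: "comb_round n m (B, D) = (B1, D1)" by (cases "comb_round n m (B, D)") blast
  obtain C1 E1 where 2: "comb_round n m (C, E) = (C1, E1)" by (cases "comb_round n m (C, E)") blast
  have "B1 = C1 \<and> D1 = E1"
    by (rule Suc.IH) (use Suc.prems 1 2 comb_inv_round[OF Suc.prems(1) _ 1] comb_inv_round[OF Suc.prems(2) _ 2] in auto)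
  then show ?case using comb_round_inj[OF Suc.prems(1,2)] Suc.prems(3) 1 2 by auto
qed simp

text \<open>
  Uncombing never resets \<open>D k k\<close>, so its states agree with those of combing only from the current
  column on.
\<close>

definition trunc :: "nat \<Rightarrow> matrix \<Rightarrow> matrix" where
  "trunc k D = (\<lambda>r j. if j < k then 0 else D r j)"

section \<open>Rounds of uncombing\<close>

definition uncomb_step ::
    "nat \<Rightarrow> nat \<Rightarrow> nat \<Rightarrow> matrix \<times> matrix \<times> (nat \<Rightarrow> int) \<Rightarrow> matrix \<times> matrix \<times> (nat \<Rightarrow> int)" where
  "uncomb_step n k i = (\<lambda>(B, D, h).
     let h = h(i := if k = 0 then int i else h i - B i (k - 1))
     in if i + 1 < n then cliffify i k (B, D, h) else (B, D, h))"

lemma uncombing_eq: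
  "uncombing n (B, D) = fst (fold (\<lambda>k. fold (uncomb_step n k) (rev [k..<n])) [0..<n] (B, D, \<lambda>_. 0))"
  by (simp add: uncombing_def uncomb_step_def[abs_def])

text \<open>If \<open>h\<close> records the right heights, cliffifying and \<open>entangle\<close>
  start from the same \<open>cur\<close>. Truncation commutes with the operation, which touches only
  column \<open>k\<close> of \<open>D\<close>.\<close>

lemma cliffify_eq:
  assumes "- gap B i k = h (Suc i) - h i - 1" and "entangle i k (B, trunc k D) = (B', D')"
  obtains E where "trunc k E = D'"
    "cliffify i k (B, D, h) = (B', E, h(Suc i := h (Suc i) - D (Suc i) k, i := h i + D (Suc i) k))"
proof
  let ?E = "upd (upd D (Suc i) k 0) i k (D i k + D (Suc i) k)"
  have "D' = upd (upd (trunc k D) (Suc i) k 0) i k (trunc k D i k + trunc k D (Suc i) k)"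
    using assms(2) by (simp add: entangle_def)
  then show "trunc k ?E = D'"
    by (simp add: trunc_def upd_apply fun_eq_iff)
  have "fst (fold (cliffify_body i) (rev [0..<k]) (B, h (Suc i) - h i - 1, D (Suc i) k)) = B'"
    using assms by (simp add: entangle_def trunc_def)
  then show "cliffify i k (B, D, h) = (B', ?E, h(Suc i := h (Suc i) - D (Suc i) k, i := h i + D (Suc i) k))"
    by (auto simp: cliffify_def Let_def upd_apply split: prod.splits)
qed

text \<open>The height of path \<open>r\<close> at the start of its turn in round \<open>k\<close>.
  It should be \<open>int r - psum B r k\<close>, the row in which the path would enter column
  \<open>k\<close> without earlier vertical steps; differences of adjacent such heights, minus one,
  are negated gaps.\<close>

definition start_height :: "nat \<Rightarrow> matrix \<Rightarrow> (nat \<Rightarrow> int) \<Rightarrow> nat \<Rightarrow> int" where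
  "start_height k B h r = (if k = 0 then int r else h r - B r (k - 1))"

text \<open>Downward induction on the row: rows from \<open>m\<close> on have correct heights, rows
  before \<open>m\<close> are as at the start of the round, and untangling from \<open>m\<close>
  upward restores that start.\<close>

lemma uncomb_round:
  assumes inv: "comb_inv n k n B (trunc k D)"
    and h: "\<And>r. k \<le> r \<Longrightarrow> r < n \<Longrightarrow> start_height k B h r = int r - psum B r k"
    and m: "k \<le> m" "m \<le> n - 1" "k < n"
    and eq: "fold (uncomb_step n k) (rev [m..<n]) (B, D, h) = (B', D', h')"
  shows "comb_inv n k m B' (trunc k D') \<and>
    (\<forall>r. m \<le> r \<and> r < n \<longrightarrow> h' r = int r - psum B' r k) \<and>
    (\<forall>r<m. h' r = h r \<and> B' r = B r) \<and>
    fold (\<lambda>i. untangle i k) [m..<n - 1] (B', trunc k D') = (B, trunc k D)"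
  using m(2,1) eq
proof (induction m arbitrary: B' D' h' rule: inc_induct)
  case base
  \<comment> \<open>The turn of row \<open>n - 1\<close> only sets a height, as there is no next
    row.\<close>
  have "[n - 1..<n] = [n - 1]" using m(3) by (cases n) auto
  then have "B' = B" "D' = D" "h' = h(n - 1 := start_height k B h (n - 1))"
    using base m(3) by (auto simp: uncomb_step_def start_height_def Let_def)
  moreover have "h' r = int r - psum B r k" if "n - 1 \<le> r" "r < n" for r
  proof -
    have "r = n - 1" using that by auto
    then show ?thesis using calculation(3) h[of r] that m(3) by simp
  qed
  ultimately show ?case using inv comb_inv_last[OF m(3)] by auto
next
  case (step m)
  obtain B1 D1 h1 where 1: "fold (uncomb_step n k) (rev [Suc m..<n]) (B, D, h) = (B1, D1, h1)"
    by (cases "fold (uncomb_step n k) (rev [Suc m..<n]) (B, D, h)") metis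
  have IH: "comb_inv n k (Suc m) B1 (trunc k D1)"
    "\<And>r. Suc m \<le> r \<Longrightarrow> r < n \<Longrightarrow> h1 r = int r - psum B1 r k"
    "\<And>r. r \<le> m \<Longrightarrow> h1 r = h r" "\<And>r. r \<le> m \<Longrightarrow> B1 r = B r"
    "fold (\<lambda>i. untangle i k) [Suc m..<n - 1] (B1, trunc k D1) = (B, trunc k D)"
    using step.IH[OF _ 1] step.prems by auto
  have mn: "Suc m < n" "k \<le> m" using step by auto
  define h2 where "h2 = h1(m := start_height k B1 h1 m)"
  \<comment> \<open>Row \<open>m\<close> is still untouched in this round, so its height can be read
    off the initial \<open>B\<close>.\<close>
  have hm: "h2 m = int m - psum B1 m k"
    using h[of m] IH(3)[of m] IH(4)[of m] mn psum_other_row[of B1 m B]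
    by (cases "k = 0") (simp_all add: h2_def start_height_def)
  have hSm: "h2 (Suc m) = int (Suc m) - psum B1 (Suc m) k" using IH(2)[of "Suc m"] mn by (simp add: h2_def)
  obtain B2 D2 where ent: "entangle m k (B1, trunc k D1) = (B2, D2)" by (cases "entangle m k (B1, trunc k D1)") blast
  have gap: "- gap B1 m k = h2 (Suc m) - h2 m - 1" using hm hSm by (simp add: gap_def)
  from cliffify_eq[OF gap ent] obtain E where E: "trunc k E = D2"
    "cliffify m k (B1, D1, h2) = (B2, E, h2(Suc m := h2 (Suc m) - D1 (Suc m) k, m := h2 m + D1 (Suc m) k))"
    by blast
  have "rev [m..<n] = rev [Suc m..<n] @ [m]" using mn by (simp add: upt_conv_Cons)
  then have "uncomb_step n k m (B1, D1, h1) = (B', D', h')" using step.prems(2) 1 by simp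
  then have "cliffify m k (B1, D1, h2) = (B', D', h')"
    using mn by (simp add: uncomb_step_def h2_def start_height_def)
  then have res: "B' = B2" "D' = E" "h' = h2(Suc m := h2 (Suc m) - D1 (Suc m) k, m := h2 m + D1 (Suc m) k)"
    using E by auto
  note ents = comb_inv_entangle[OF IH(1) mn(2,1) ent]
  have D1: "trunc k D1 (Suc m) k = D1 (Suc m) k" by (simp add: trunc_def)
  \<comment> \<open>The prefix sums at \<open>k\<close> of the two rows shift by
    \<open>D (Suc m) k\<close> in opposite directions, and the updates of \<open>h\<close> follow
    them.\<close>
  have heights: "h' r = int r - psum B' r k" if r: "m \<le> r" "r < n" for r
  proof -
    consider "r = m" | "r = Suc m" | "Suc m < r" using r by linarith
    then show ?thesis
    proof cases
      case 1
      then show ?thesis using res hm ents(3) D1 by simp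
    next
      case 2
      then show ?thesis using res hSm ents(4) D1 by simp
    next
      case 3
      then show ?thesis
        using res IH(2)[of r] r ents(5)[of r] psum_other_row[of B2 r B1] by (simp add: h2_def)
    qed
  qed
  have "h' r = h r \<and> B' r = B r" if "r < m" for r
    using that res IH(3,4)[of r] ents(5)[of r] by (simp add: h2_def)
  moreover have "fold (\<lambda>i. untangle i k) [m..<n - 1] (B', trunc k D') = (B, trunc k D)"
  proof -
    have "[m..<n - 1] = m # [Suc m..<n - 1]" using step by (simp add: upt_conv_Cons)
    then show ?thesis using ents(2) res E IH(5) by simp
  qed
  ultimately show ?case using ents(1) res E heights by simp
qed

text \<open>Each round of uncombing is undone by the combing round for the same column, so the
  rounds cancel from the inside. Truncation discards the entries \<open>D k k\<close> left
  behind.\<close>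

lemma uncomb_rounds:
  assumes inv: "comb_inv n 0 n B D" and "m \<le> n"
    and eq: "fold (\<lambda>k. fold (uncomb_step n k) (rev [k..<n])) [0..<m] (B, D, h) = (B', D', h')"
  shows "comb_inv n m n B' (trunc m D') \<and>
    (\<forall>r. m \<le> r \<and> r < n \<longrightarrow> start_height m B' h' r = int r - psum B' r m) \<and>
    fold (comb_round n) (rev [0..<m]) (B', trunc m D') = (B, D)"
  using assms(2,3)
proof (induction m arbitrary: B' D' h')
  case 0
  then show ?case using inv by (simp add: start_height_def trunc_def)
next
  case (Suc k)
  obtain B1 D1 h1 where 1: "fold (\<lambda>k. fold (uncomb_step n k) (rev [k..<n])) [0..<k] (B, D, h) = (B1, D1, h1)"
    by (cases "fold (\<lambda>k. fold (uncomb_step n k) (rev [k..<n])) [0..<k] (B, D, h)") metis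
  have IH: "comb_inv n k n B1 (trunc k D1)"
    "\<And>r. k \<le> r \<Longrightarrow> r < n \<Longrightarrow> start_height k B1 h1 r = int r - psum B1 r k"
    "fold (comb_round n) (rev [0..<k]) (B1, trunc k D1) = (B, D)"
    using Suc.IH[OF _ 1] Suc.prems by auto
  have step: "fold (uncomb_step n k) (rev [k..<n]) (B1, D1, h1) = (B', D', h')"
    using Suc.prems 1 by simp
  have k: "k < n" "k \<le> n - 1" using Suc.prems by auto
  note r = uncomb_round[OF IH(1,2) order_refl k(2,1) step, simplified]
  then have inv': "comb_inv n k k B' (trunc k D')" by blast
  \<comment> \<open>Only \<open>D' k k\<close> can survive in column \<open>k\<close>, so truncating
    one column further amounts to resetting that entry.\<close>
  have col: "D' x k = 0" if "x \<noteq> k" for x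
    using comb_invD(4)[OF inv', of x k] that by (cases "D' x k = 0") (auto simp: trunc_def)
  have tr: "trunc (Suc k) D' = upd (trunc k D') k k 0"
    by (auto simp: trunc_def upd_def fun_eq_iff less_Suc_eq col)
  \<comment> \<open>The total of row \<open>k\<close> forces the discarded entry to be the one that
    combing computes from \<open>B'\<close>.\<close>
  have "upd (trunc (Suc k) D') k k (int k - (\<Sum>j<k. B' k j)) = trunc k D'"
    using comb_inv_round_finish(2)[OF inv' k(1)] unfolding tr by (auto simp: upd_def fun_eq_iff)
  then have "comb_round n k (B', trunc (Suc k) D') = (B1, trunc k D1)"
    using r by (simp add: comb_round_def)
  then show ?case
    using r IH(3) comb_inv_round_finish(1)[OF inv' k(1)] k
    by (auto simp: tr start_height_def psum_Suc)
qed

lemma combing_uncombing: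
  assumes "comb_inv n 0 n B D"
  shows "comb_inv n n n (uncombing n (B, D)) (\<lambda>_ _. 0)"
    and "combing n (uncombing n (B, D)) = (B, D)"
proof -
  obtain B' D' h' where eq: "fold (\<lambda>k. fold (uncomb_step n k) (rev [k..<n])) [0..<n] (B, D, \<lambda>_. 0) = (B', D', h')"
    by (cases "fold (\<lambda>k. fold (uncomb_step n k) (rev [k..<n])) [0..<n] (B, D, \<lambda>_. 0)") metis
  note r = uncomb_rounds[OF assms order_refl eq]
  have tr: "trunc n D' = (\<lambda>_ _. 0)"
    using comb_invD(4)[OF conjunct1[OF r]] by (fastforce simp: fun_eq_iff)
  have u: "uncombing n (B, D) = B'" by (simp add: uncombing_eq eq)
  show "comb_inv n n n (uncombing n (B, D)) (\<lambda>_ _. 0)" "combing n (uncombing n (B, D)) = (B, D)"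
    using r by (simp_all add: tr u combing_eq)
qed


section \<open>Paths and their codes\<close>

primrec walk :: "point \<Rightarrow> point list \<Rightarrow> point list" where
  "walk p [] = [p]"
| "walk p (s # ss) = p # walk (p + s) ss"

lemma walk_neq_Nil [simp]: "walk p ss \<noteq> []"
  by (cases ss) auto

lemma hd_walk [simp]: "hd (walk p ss) = p"
  by (cases ss) auto

lemma last_walk: "last (walk p ss) = p + sum_list ss"
  by (induction ss arbitrary: p) (auto simp: add.assoc)

lemma steps_walk_Nil [simp]: "steps (walk p []) = []"
  by (simp add: steps_def)

lemma steps_walk_Cons [simp]: "steps (walk p (s # ss)) = (p, p + s) # steps (walk (p + s) ss)"
  by (cases ss) (simp_all add: steps_def)

lemma steps_walk_append:
  "steps (walk p (ss @ ts)) = steps (walk p ss) @ steps (walk (p + sum_list ss) ts)"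
  by (induction ss arbitrary: p) (simp_all add: add.assoc del: walk.simps)

lemma set_walk_append:
  "set (walk p (ss @ ts)) = set (walk p ss) \<union> set (walk (p + sum_list ss) ts)"
proof (induction ss arbitrary: p)
  case Nil
  then show ?case by (cases ts) auto
qed (auto simp: add.assoc)

lemma differences_walk: "map (\<lambda>(a, b). b - a) (steps (walk p ss)) = ss"
  by (induction ss arbitrary: p) (simp_all del: walk.simps)

lemma walk_differences:
  assumes "P \<noteq> []"
  shows "P = walk (hd P) (map (\<lambda>(a, b). b - a) (steps P))"
  using assms
proof (induction P)
  case (Cons p P)
  show ?case
  proof (cases P)
    case Nil
    then show ?thesis by (simp add: steps_def)
  next
    case (Cons q Q)
    then have "steps (p # P) = (p, q) # steps P" by (simp add: steps_def)
    then show ?thesis using Cons.IH Cons by simp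
  qed
qed simp

lemma schroeder_path_walk:
  "schroeder_path p q (walk p ss) \<longleftrightarrow>
     set ss \<subseteq> {horizontal, diagonal, vertical} \<and> p + sum_list ss = q"
proof -
  have *: "(\<forall>(a, b) \<in> set (steps (walk p ss)). b - a \<in> X) \<longleftrightarrow> set ss \<subseteq> X" for X
    by (subst (2) differences_walk[of p ss, symmetric]) auto
  show ?thesis unfolding schroeder_path_def * by (simp add: last_walk conj_commute)
qed

section \<open>Words of steps sorted by columns\<close>

primrec row_steps :: "(nat \<Rightarrow> int) \<Rightarrow> (nat \<Rightarrow> int) \<Rightarrow> nat \<Rightarrow> point list" where
  "row_steps b d 0 = replicate (nat (d 0)) vertical"
| "row_steps b d (Suc m) = row_steps b d m @
     (if b m = 1 then diagonal else horizontal) # replicate (nat (d (Suc m))) vertical"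

lemma row_steps_cong:
  "(\<And>j. j < m \<Longrightarrow> b j = b' j) \<Longrightarrow> (\<And>j. j \<le> m \<Longrightarrow> d j = d' j) \<Longrightarrow>
    row_steps b d m = row_steps b' d' m"
  by (induction m) auto

text \<open>The word is read letter by letter: a vertical step increases the last count, and any
  other step opens a new column with count \<open>0\<close>.\<close>

lemma row_steps_exists:
  assumes "set ss \<subseteq> {horizontal, diagonal, vertical}"
  shows "\<exists>b d m. (\<forall>j. b j \<in> {0, 1}) \<and> (\<forall>j. 0 \<le> d j) \<and> ss = row_steps b d m"
  using assms
proof (induction ss rule: rev_induct)
  case Nil
  show ?case
    by (rule exI[of _ "\<lambda>_. 0"], rule exI[of _ "\<lambda>_. 0"], rule exI[of _ 0]) simp
next
  case (snoc s ss)
  then obtain b d m where bd: "\<forall>j. b j \<in> {0, 1}" "\<forall>j. 0 \<le> d j" "ss = row_steps b d m"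
    by auto
  show ?case
  proof (cases "s = vertical")
    case True
    define d' where "d' = d(m := d m + 1)"
    have "row_steps b d' m = row_steps b d m @ [vertical]"
    proof (cases m)
      case 0
      then show ?thesis using bd(2)
        by (simp add: d'_def nat_add_distrib replicate_append_same)
    next
      case (Suc l)
      have "row_steps b d' l = row_steps b d l"
        by (rule row_steps_cong) (auto simp: d'_def Suc)
      then show ?thesis using bd(2)
        by (simp add: d'_def Suc nat_add_distrib replicate_append_same)
    qed
    moreover have "\<forall>j. 0 \<le> d' j" using bd(2) by (simp add: d'_def)
    ultimately show ?thesis using bd True by metis
  next
    case False
    \<comment> \<open>Overwriting \<open>b\<close> at \<open>m\<close> and \<open>d\<close> at
      \<open>Suc m\<close> is harmless, since the word up to column \<open>m\<close> does not read
      these values.\<close>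
    define b' where "b' = b(m := if s = diagonal then 1 else 0)"
    define d' where "d' = d(Suc m := 0)"
    have "row_steps b' d' m = row_steps b d m"
      by (rule row_steps_cong) (auto simp: b'_def d'_def)
    moreover have "s = diagonal \<or> s = horizontal" using False snoc.prems by auto
    ultimately have "row_steps b' d' (Suc m) = ss @ [s]"
      by (auto simp: b'_def d'_def bd(3))
    moreover have "\<forall>j. b' j \<in> {0, 1}" "\<forall>j. 0 \<le> d' j"
      using bd(1,2) by (simp_all add: b'_def d'_def)
    ultimately show ?thesis by metis
  qed
qed

lemma sum_list_replicate_vertical: "sum_list (replicate c vertical) = (- int c, 0)"
  by (induction c) (auto simp: vertical_def zero_prod_def)

lemma sum_list_row_steps:
  assumes "\<And>j. b j \<in> {0, 1}" "\<And>j. 0 \<le> d j"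
  shows "sum_list (row_steps b d m) = (- (\<Sum>j<m. b j) - (\<Sum>j<Suc m. d j), int m)"
proof (induction m)
  case 0
  then show ?case using assms(2)[of 0] by (simp add: sum_list_replicate_vertical)
next
  case (Suc m)
  then show ?case using assms(1)[of m] assms(2)[of "Suc m"]
    by (auto simp: sum_list_replicate_vertical diagonal_def horizontal_def)
qed

lemma set_row_steps: "set (row_steps b d m) \<subseteq> {horizontal, diagonal, vertical}"
  by (induction m) auto

lemma set_walk_vertical:
  "set (walk (x, y) (replicate c vertical)) = {(r, y) |r. x - int c \<le> r \<and> r \<le> x}"
  by (induction c arbitrary: x) (auto simp: vertical_def)

lemma steps_walk_vertical:
  "(a, b) \<in> set (steps (walk (x, y) (replicate c vertical))) \<Longrightarrow> snd a = y \<and> b - a = vertical"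
  by (induction c arbitrary: x) (auto simp: vertical_def simp del: walk.simps)

lemma no_diagonal_step_vertical:
  "\<not> (\<exists>(p, q) \<in> set (steps (walk (x, y) (replicate c vertical))). snd p = z \<and> q - p = diagonal)"
proof -
  have "vertical \<noteq> diagonal" by (simp add: vertical_def diagonal_def)
  then show ?thesis using steps_walk_vertical by fastforce
qed

lemma length_steps_walk: "length (steps (walk p ss)) = length ss"
  by (metis differences_walk length_map)

lemma set_walk_row_steps:
  assumes "\<And>j. b j \<in> {0, 1}" "\<And>j. 0 \<le> d j"
  shows "set (walk (x, 0) (row_steps b d m)) =
    {(r, int j) |r j. j \<le> m \<and> x - (\<Sum>l<j. b l) - (\<Sum>l<Suc j. d l) \<le> r \<and>
       r \<le> x - (\<Sum>l<j. b l) - (\<Sum>l<j. d l)}" (is "_ = ?S m")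
proof (induction m)
  case 0
  show ?case using assms(2)[of 0] by (auto simp: set_walk_vertical)
next
  case (Suc m)
  \<comment> \<open>The end point of the part up to column \<open>m\<close>. The remaining walk
    starts there, and the point already lies on the first part, so it adds nothing to the
    union.\<close>
  define e where "e = (x, 0) + sum_list (row_steps b d m)"
  have e: "e = (x - (\<Sum>j<m. b j) - (\<Sum>j<Suc m. d j), int m)"
    using sum_list_row_steps[of b d m] assms by (simp add: e_def)
  have e_in: "e \<in> set (walk (x, 0) (row_steps b d m))"
    unfolding Suc e using assms(2)[of m] by auto
  let ?s = "if b m = 1 then diagonal else horizontal"
  have es: "e + ?s = (x - (\<Sum>j<Suc m. b j) - (\<Sum>j<Suc m. d j), int (Suc m))"
    using assms(1)[of m] by (auto simp: e diagonal_def horizontal_def)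
  have "set (walk (x, 0) (row_steps b d (Suc m))) =
      ?S m \<union> set (walk (e + ?s) (replicate (nat (d (Suc m))) vertical))"
    using e_in Suc by (simp add: set_walk_append flip: e_def) blast
  also have "\<dots> = ?S (Suc m)"
    unfolding es set_walk_vertical using assms(2)[of "Suc m"]
    by (auto simp: le_Suc_eq simp del: of_nat_Suc)
  finally show ?case .
qed

lemma diagonal_steps_row_steps:
  assumes "\<And>j. b j \<in> {0, 1}" "\<And>j. 0 \<le> d j"
  shows "(\<exists>(p, q) \<in> set (steps (walk (x, 0) (row_steps b d m))). snd p = int j \<and> q - p = diagonal)
    \<longleftrightarrow> j < m \<and> b j = 1"
proof (induction m)
  case 0
  show ?case using no_diagonal_step_vertical by simp
next
  case (Suc m)
  define e where "e = (x, 0) + sum_list (row_steps b d m)"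
  have e: "snd e = int m"
    using sum_list_row_steps[of b d m] assms by (simp add: e_def)
  let ?s = "if b m = 1 then diagonal else horizontal"
  obtain u v where uv: "e + ?s = (u, v)" by (cases "e + ?s")
  have "\<not> (\<exists>(p, q) \<in> set (steps (walk (u, v) (replicate (nat (d (Suc m))) vertical))).
      snd p = int j \<and> q - p = diagonal)"
    by (rule no_diagonal_step_vertical)
  moreover have "steps (walk (x, 0) (row_steps b d (Suc m))) = steps (walk (x, 0) (row_steps b d m)) @
      (e, e + ?s) # steps (walk (u, v) (replicate (nat (d (Suc m))) vertical))"
    by (simp add: steps_walk_append uv del: walk.simps flip: e_def)
  moreover have "e + ?s - e = diagonal \<longleftrightarrow> b m = 1"
    by (auto simp: diagonal_def horizontal_def)
  ultimately show ?case using Suc e by (auto simp: less_Suc_eq)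
qed

lemma vertical_steps_row_steps:
  assumes "\<And>j. b j \<in> {0, 1}" "\<And>j. 0 \<le> d j"
  shows "int (length (filter (\<lambda>(p, q). snd p = int j \<and> q - p = vertical)
      (steps (walk (x, 0) (row_steps b d m))))) = (if j \<le> m then d j else 0)"
proof (induction m)
  case 0
  have "filter (\<lambda>(p, q). snd p = int j \<and> q - p = vertical)
      (steps (walk (x, 0) (replicate (nat (d 0)) vertical))) =
      (if j = 0 then steps (walk (x, 0) (replicate (nat (d 0)) vertical)) else [])"
    by (auto simp: filter_id_conv filter_empty_conv dest!: steps_walk_vertical)
  then show ?case using assms(2)[of 0] by (simp add: length_steps_walk)
next
  case (Suc m)
  define e where "e = (x, 0) + sum_list (row_steps b d m)"
  have e: "snd e = int m"
    using sum_list_row_steps[of b d m] assms by (simp add: e_def)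
  let ?s = "if b m = 1 then diagonal else horizontal"
  obtain u v where uv: "e + ?s = (u, v)" by (cases "e + ?s")
  have v: "v = int (Suc m)"
    using arg_cong[OF uv, of snd] e by (auto simp: diagonal_def horizontal_def split: if_splits)
  let ?t = "steps (walk (u, v) (replicate (nat (d (Suc m))) vertical))"
  have "filter (\<lambda>(p, q). snd p = int j \<and> q - p = vertical) ?t = (if j = Suc m then ?t else [])"
    by (auto simp: filter_id_conv filter_empty_conv v dest!: steps_walk_vertical)
  moreover have "steps (walk (x, 0) (row_steps b d (Suc m))) = steps (walk (x, 0) (row_steps b d m)) @
      (e, e + ?s) # ?t"
    by (simp add: steps_walk_append uv del: walk.simps flip: e_def)
  moreover have "e + ?s - e \<noteq> vertical"
    by (auto simp: diagonal_def horizontal_def vertical_def)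
  ultimately show ?case using Suc assms(2)[of "Suc m"]
    by (cases "j = Suc m") (auto simp: length_steps_walk)
qed

section \<open>Codes of families, and disjointness as an order of adjacent paths\<close>

definition row_code :: "nat \<Rightarrow> matrix \<Rightarrow> matrix \<Rightarrow> bool" where
  "row_code n B D \<longleftrightarrow> binary B \<and> (\<forall>r j. B r j \<noteq> 0 \<longrightarrow> j < r \<and> r < n) \<and>
     (\<forall>r j. 0 \<le> D r j) \<and> (\<forall>r j. D r j \<noteq> 0 \<longrightarrow> j \<le> r \<and> r < n) \<and>
     (\<forall>r<n. psum B r (Suc r) + psum D r (Suc r) = int r)"

definition path_of :: "matrix \<Rightarrow> matrix \<Rightarrow> nat \<Rightarrow> point list" where
  "path_of B D i = walk (int i, 0) (row_steps (B i) (D i) i)"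

text \<open>The row in which path \<open>i\<close> enters column \<open>j\<close>; it leaves this column in row \<open>row_top B D i j - D i j\<close>.\<close>

definition row_top :: "matrix \<Rightarrow> matrix \<Rightarrow> nat \<Rightarrow> nat \<Rightarrow> int" where
  "row_top B D i j = int i - psum B i j - psum D i j"

lemma row_codeD:
  assumes "row_code n B D"
  shows "binary B" "B r j \<in> {0, 1}" "B r j \<noteq> 0 \<Longrightarrow> j < r \<and> r < n" "0 \<le> D r j"
    "D r j \<noteq> 0 \<Longrightarrow> j \<le> r \<and> r < n" "r < n \<Longrightarrow> psum B r (Suc r) + psum D r (Suc r) = int r"
    "r < n \<Longrightarrow> psum B r r + psum D r (Suc r) = int r"
proof -
  note d = assms[unfolded row_code_def]
  show "binary B" "B r j \<in> {0, 1}" "B r j \<noteq> 0 \<Longrightarrow> j < r \<and> r < n" "0 \<le> D r j"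
    "D r j \<noteq> 0 \<Longrightarrow> j \<le> r \<and> r < n" "r < n \<Longrightarrow> psum B r (Suc r) + psum D r (Suc r) = int r"
    using d by (auto simp: binary_def)
  have "B r r = 0" using d by blast
  then show "r < n \<Longrightarrow> psum B r r + psum D r (Suc r) = int r"
    using d psum_Suc[of B r r] by auto
qed

lemma set_path_of:
  assumes "row_code n B D"
  shows "set (path_of B D i) = {(r, int j) |r j. j \<le> i \<and> row_top B D i j - D i j \<le> r \<and> r \<le> row_top B D i j}"
  using set_walk_row_steps[of "B i" "D i" "int i" i] row_codeD(2,4)[OF assms]
  by (simp add: path_of_def row_top_def psum_def algebra_simps)

lemma nfamily_path_of:
  assumes "row_code n B D"
  shows "nfamily n (map (path_of B D) [0..<n])"
proof -
  have "schroeder_path (int i, 0) (0, int i) (path_of B D i)" if "i < n" for i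
    unfolding path_of_def schroeder_path_walk
      sum_list_row_steps[OF row_codeD(2)[OF assms] row_codeD(4)[OF assms]]
    using row_codeD(7)[OF assms that] set_row_steps by (simp add: psum_def)
  then show ?thesis by (simp add: nfamily_def)
qed

lemma encode_path_of:
  assumes "row_code n B D"
  shows "encode n (map (path_of B D) [0..<n]) = (B, D)"
proof -
  note b = row_codeD(2)[OF assms] and d = row_codeD(4)[OF assms]
  have "diag_matrix n (map (path_of B D) [0..<n]) i j = B i j" for i j
  proof -
    have "diag_matrix n (map (path_of B D) [0..<n]) i j = (if j < i \<and> i < n \<and>
        (\<exists>(p, q) \<in> set (steps (path_of B D i)). snd p = int j \<and> q - p = diagonal) then 1 else 0)"
      by (simp add: diag_matrix_def cong: conj_cong)
    also have "\<dots> = B i j"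
      unfolding path_of_def diagonal_steps_row_steps[OF b d]
      using b[of i j] row_codeD(3)[OF assms, of i j] by auto
    finally show ?thesis .
  qed
  moreover have "vert_matrix n (map (path_of B D) [0..<n]) i j = D i j" for i j
    using vertical_steps_row_steps[of "B i" "D i" j "int i" i, OF b d] row_codeD(5)[OF assms, of i j]
    by (auto simp: vert_matrix_def path_of_def)
  ultimately show ?thesis by (simp add: encode_def fun_eq_iff)
qed

lemma path_row_steps:
  assumes "schroeder_path (int i, 0) (0, int i) P"
  obtains b d where "\<And>j. b j \<in> {0, 1}" "\<And>j. 0 \<le> d j" "P = walk (int i, 0) (row_steps b d i)"
    "(\<Sum>j<i. b j) + (\<Sum>j<Suc i. d j) = int i"
proof -
  define ss where "ss = map (\<lambda>(a, b). b - a) (steps P)"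
  have P: "P = walk (int i, 0) ss"
    using walk_differences[of P] assms by (auto simp: ss_def schroeder_path_def)
  have ss: "set ss \<subseteq> {horizontal, diagonal, vertical}" "(int i, 0) + sum_list ss = (0, int i)"
    using assms schroeder_path_walk unfolding P by blast+
  obtain b d m where bd: "\<And>j. b j \<in> {0, 1}" "\<And>j. 0 \<le> d j" "ss = row_steps b d m"
    using row_steps_exists[OF ss(1)] by blast
  \<comment> \<open>The end point decides both: its second coordinate counts the columns crossed,
    its first the total descent.\<close>
  have "m = i" "(\<Sum>j<i. b j) + (\<Sum>j<Suc i. d j) = int i"
    using ss(2) sum_list_row_steps[of b d m, OF bd(1,2)] by (auto simp: bd(3))
  then show ?thesis using that bd P by blast
qed

text \<open>The code agrees with \<open>b\<close> and \<open>d\<close> in the columns that path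
  \<open>i\<close> visits, and \<open>row_steps\<close> reads no other values.\<close>

lemma nfamily_encode:
  assumes "nfamily n Ps" and "encode n Ps = (B, D)"
  shows "row_code n B D" and "Ps = map (path_of B D) [0..<n]"
proof -
  have B: "B = diag_matrix n Ps" and D: "D = vert_matrix n Ps"
    using assms(2) by (auto simp: encode_def)
  have zero: "\<not> i < n \<Longrightarrow> B i j = 0" "\<not> i < n \<Longrightarrow> D i j = 0" "\<not> j < i \<Longrightarrow> B i j = 0" "\<not> j \<le> i \<Longrightarrow> D i j = 0" for i j
    by (auto simp: B D diag_matrix_def vert_matrix_def)
  have row: "path_of B D i = Ps ! i \<and> psum B i (Suc i) + psum D i (Suc i) = int i" if "i < n" for i
  proof -
    have "schroeder_path (int i, 0) (0, int i) (Ps ! i)"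
      using assms(1) that by (simp add: nfamily_def)
    then obtain b d where bd: "\<And>j. b j \<in> {0, 1}" "\<And>j. 0 \<le> d j"
      "Ps ! i = walk (int i, 0) (row_steps b d i)" "(\<Sum>j<i. b j) + (\<Sum>j<Suc i. d j) = int i"
      using path_row_steps by blast
    have Bi: "B i j = b j" if "j < i" for j
      using diagonal_steps_row_steps[of b d "int i" i j, OF bd(1,2)] bd(1)[of j] that \<open>i < n\<close>
      by (auto simp: B diag_matrix_def bd(3))
    have Di: "D i j = d j" if "j \<le> i" for j
      using vertical_steps_row_steps[of b d j "int i" i, OF bd(1,2)] that \<open>i < n\<close>
      by (auto simp: D vert_matrix_def bd(3))
    have "row_steps (B i) (D i) i = row_steps b d i"
      by (rule row_steps_cong) (auto simp: Bi Di)
    moreover have "psum B i (Suc i) = (\<Sum>j<i. b j)" "psum D i (Suc i) = (\<Sum>j<Suc i. d j)"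
      using zero(3)[of i i] by (auto simp: psum_def Bi Di)
    ultimately show ?thesis using bd by (simp add: path_of_def)
  qed
  have "B i j \<in> {0, 1}" "0 \<le> D i j" for i j
    by (auto simp: B D diag_matrix_def vert_matrix_def)
  then show "row_code n B D"
    using row zero unfolding row_code_def binary_def by metis
  show "Ps = map (path_of B D) [0..<n]"
    using assms(1) row by (intro nth_equalityI) (auto simp: nfamily_def)
qed

text \<open>At \<open>k = 0\<close> the bounds on prefix gaps reduce to \<open>t = 0\<close>, at
  \<open>i = n\<close> there is no current pair, and the remaining gap condition is the order of
  adjacent paths, written with \<open>row_top\<close>.\<close>

lemma comb_inv_0_iff:
  "comb_inv n 0 n B D \<longleftrightarrow> row_code n B D \<and>
    (\<forall>r j. j \<le> r \<and> Suc r < n \<longrightarrow> row_top B D r j < row_top B D (Suc r) j - D (Suc r) j)"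
proof -
  have "row_top B D r j < row_top B D (Suc r) j - D (Suc r) j \<longleftrightarrow> gap B r j + gap D r j + D (Suc r) j \<le> 0" for r j
    by (auto simp: row_top_def gap_def)
  moreover have "r < n \<and> (j = 0 \<longrightarrow> r \<le> n) \<longleftrightarrow> r < n" for r j :: nat by auto
  ultimately show ?thesis
    unfolding comb_inv_def row_code_def by auto
qed

lemma row_top_Suc: "row_top B D r (Suc j) = row_top B D r j - D r j - B r j"
  by (simp add: row_top_def psum_Suc)

lemma row_top_last: "row_code n B D \<Longrightarrow> r < n \<Longrightarrow> row_top B D r r - D r r = 0"
  using row_codeD(7)[of n B D r] by (simp add: row_top_def psum_Suc)

text \<open>Crossing to the next column lowers path \<open>r + 1\<close> by at most one row, so a
  strict order in one column leaves the tops weakly ordered in the next; disjointness makes the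
  order strict again.\<close>

lemma ordered_of_disjoint:
  assumes rc: "row_code n B D" and r: "Suc r < n"
    and dis: "set (path_of B D r) \<inter> set (path_of B D (Suc r)) = {}"
  shows "j \<le> r \<Longrightarrow> row_top B D r j < row_top B D (Suc r) j - D (Suc r) j"
proof -
  \<comment> \<open>If the order failed, the point where path \<open>r\<close> enters column
    \<open>j\<close> would lie on both paths.\<close>
  have gtI: "row_top B D r j < row_top B D (Suc r) j - D (Suc r) j"
    if "j \<le> r" "row_top B D r j \<le> row_top B D (Suc r) j" for j
  proof (rule ccontr)
    assume "\<not> ?thesis"
    then have "(row_top B D r j, int j) \<in> set (path_of B D r) \<inter> set (path_of B D (Suc r))"
      using that row_codeD(4)[OF rc, of r j] unfolding set_path_of[OF rc] by auto
    then show False using dis by blast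
  qed
  show "j \<le> r \<Longrightarrow> row_top B D r j < row_top B D (Suc r) j - D (Suc r) j"
  proof (induction j)
    case 0
    show ?case by (rule gtI) (simp_all add: row_top_def)
  next
    case (Suc j)
    then show ?case
      using row_codeD(2)[OF rc, of r j] row_codeD(2)[OF rc, of "Suc r" j] row_codeD(4)[OF rc, of r j]
      by (intro gtI) (auto simp: row_top_Suc)
  qed
qed

lemma ordered_tops:
  assumes rc: "row_code n B D"
    and ord: "\<And>r j. j \<le> r \<Longrightarrow> Suc r < n \<Longrightarrow> row_top B D r j < row_top B D (Suc r) j - D (Suc r) j"
    and "i \<le> r" "r < n" "j \<le> i"
  shows "row_top B D i j + int (r - i) \<le> row_top B D r j"
  using \<open>i \<le> r\<close> \<open>r < n\<close>
proof (induction r rule: dec_induct)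
  case (step r)
  then show ?case using ord[of j r] row_codeD(4)[OF rc, of "Suc r" j] \<open>j \<le> i\<close>
    by (simp add: Suc_diff_le)
qed simp

text \<open>The distance \<open>int (r - i)\<close> serves twice: being positive it separates paths
  that need not be adjacent, and its size yields the Schroeder condition.\<close>

lemma ordered_paths:
  assumes rc: "row_code n B D"
    and ord: "\<And>r j. j \<le> r \<Longrightarrow> Suc r < n \<Longrightarrow> row_top B D r j < row_top B D (Suc r) j - D (Suc r) j"
    and "i < r" "r < n" "j \<le> i"
  shows "row_top B D i j + int (r - i) \<le> row_top B D r j - D r j"
proof -
  obtain l where l: "r = Suc l" using \<open>i < r\<close> by (cases r) auto
  then show ?thesis
    using ordered_tops[OF rc ord, of i l j] ord[of j l] assms(3-5) by (simp add: Suc_diff_le)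
qed

lemma disjoint_schroeder_codes_eq:
  "disjoint_schroeder_codes n = {(B, D). comb_inv n 0 n B D}"
proof (intro equalityI subsetI)
  fix x assume "x \<in> disjoint_schroeder_codes n"
  then obtain Ps where Ps: "x = encode n Ps" "disjoint_nfamily n Ps"
    by (auto simp: disjoint_schroeder_codes_def)
  obtain B D where x: "x = (B, D)" by (cases x)
  have nf: "nfamily n Ps" using Ps by (simp add: disjoint_nfamily_def)
  note e = nfamily_encode[OF nf, of B D]
  have rc: "row_code n B D" and P: "Ps = map (path_of B D) [0..<n]" using e Ps x by auto
  have "set (path_of B D i) \<inter> set (path_of B D j) = {}" if "i < n" "j < n" "i \<noteq> j" for i j
    using Ps(2) that unfolding disjoint_nfamily_def P by auto
  then show "x \<in> {(B, D). comb_inv n 0 n B D}"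
    using ordered_of_disjoint[OF rc] rc by (auto simp: x comb_inv_0_iff)
next
  fix x assume "x \<in> {(B, D). comb_inv n 0 n B D}"
  then obtain B D where x: "x = (B, D)" "row_code n B D"
    "\<And>r j. j \<le> r \<Longrightarrow> Suc r < n \<Longrightarrow> row_top B D r j < row_top B D (Suc r) j - D (Suc r) j"
    by (auto simp: comb_inv_0_iff)
  define Ps where "Ps = map (path_of B D) [0..<n]"
  have nf: "nfamily n Ps" and enc: "encode n Ps = (B, D)"
    using nfamily_path_of[OF x(2)] encode_path_of[OF x(2)] by (simp_all add: Ps_def)
  have less: "set (path_of B D i) \<inter> set (path_of B D r) = {}" if "i < r" "r < n" for i r
  proof (rule ccontr)
    assume "\<not> ?thesis"
    then obtain y j where "j \<le> i" "y \<le> row_top B D i j" "row_top B D r j - D r j \<le> y"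
      unfolding set_path_of[OF x(2)] by auto
    then show False using ordered_paths[OF x(2,3), of i r j] that by force
  qed
  have "disjoint_nfamily n Ps"
    unfolding disjoint_nfamily_def
  proof (intro conjI nf allI impI)
    fix i j assume "i < n" "j < n" "i \<noteq> j"
    then show "set (Ps ! i) \<inter> set (Ps ! j) = {}"
      using less[of i j] less[of j i] by (cases i j rule: linorder_cases) (auto simp: Ps_def)
  qed
  moreover have "schroeder_nfamily n Ps"
    unfolding schroeder_nfamily_def
  proof (intro conjI nf allI impI)
    fix i assume i: "i < n"
    \<comment> \<open>Path \<open>j\<close> leaves column \<open>j\<close>, its last one, in row
      \<open>0\<close>. So it enters that column in a nonnegative row, and path \<open>i\<close>
      stays at least \<open>i - j\<close> rows further up.\<close>
    have "int i \<le> y + int j" if "j \<le> i" "row_top B D i j - D i j \<le> y" for y j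
      using ordered_paths[OF x(2,3), of j i j] row_top_last[OF x(2), of j] row_codeD(4)[OF x(2), of j j] that i
      by (cases "i = j") auto
    then show "\<forall>(k, l)\<in>set (Ps ! i). k + l \<ge> int i"
      using i unfolding Ps_def by (auto simp: set_path_of[OF x(2)])
  qed
  ultimately show "x \<in> disjoint_schroeder_codes n"
    using enc x(1) by (force simp: disjoint_schroeder_codes_def)
qed

section \<open>Codes of cliff-shaped families\<close>

lemma cliff_shaped_walk:
  "cliff_shaped i (walk p ss) \<longleftrightarrow>
    set (take i ss) \<subseteq> {horizontal, diagonal} \<and> set (drop i ss) \<subseteq> {vertical}"
proof -
  define f :: "point \<times> point \<Rightarrow> point" where "f = (\<lambda>(a, b). b - a)"
  have "set (take i ss) = f ` set (take i (steps (walk p ss)))"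
    "set (drop i ss) = f ` set (drop i (steps (walk p ss)))"
    using differences_walk[of p ss] by (metis f_def list.set_map take_map drop_map)+
  then show ?thesis
    by (auto simp: cliff_shaped_def f_def split: prod.splits)
qed

lemma row_steps_cliff:
  "(\<And>j. j < m \<Longrightarrow> d j = 0) \<Longrightarrow> row_steps b d m =
    map (\<lambda>j. if b j = 1 then diagonal else horizontal) [0..<m] @ replicate (nat (d m)) vertical"
proof (induction m)
  case (Suc m)
  then show ?case using Suc.prems[of m] by simp
qed simp

text \<open>At \<open>k = n\<close> with \<open>D\<close> zero the invariant leaves only binary,
  strictly lower triangular matrices.\<close>

lemma cliff_codes_eq: "cliff_codes n = {B. comb_inv n n n B (\<lambda>_ _. 0)}"
proof (intro equalityI subsetI)
  fix B assume "B \<in> cliff_codes n"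
  then obtain Ps where "B = diag_matrix n Ps" by (auto simp: cliff_codes_def)
  then show "B \<in> {B. comb_inv n n n B (\<lambda>_ _. 0)}"
    by (auto simp: comb_inv_def diag_matrix_def binary_def)
next
  fix B assume "B \<in> {B. comb_inv n n n B (\<lambda>_ _. 0)}"
  then have bin: "binary B" and supp: "\<And>r j. B r j \<noteq> 0 \<Longrightarrow> j < r \<and> r < n"
    by (simp_all add: comb_inv_def)
  \<comment> \<open>The descent not made by diagonal steps is put into the last column of each path;
    the end point forces its amount.\<close>
  define D :: matrix where "D = (\<lambda>r j. if j = r \<and> r < n then int r - psum B r r else 0)"
  have D: "psum D r j = (if r < j \<and> r < n then int r - psum B r r else 0)" for r j
    by (induction j) (auto simp: psum_Suc D_def)
  have rc: "row_code n B D"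
    unfolding row_code_def
  proof (intro conjI allI impI)
    show "0 \<le> D r j" for r j
      using psum_le[OF bin, of 0 r r] by (auto simp: D_def)
    show "psum B r (Suc r) + psum D r (Suc r) = int r" if "r < n" for r
      using supp[of r r] that by (cases "B r r = 0") (auto simp: D psum_Suc[of B])
  qed (use bin supp in \<open>auto simp: D_def split: if_splits\<close>)
  have "cliff_shaped i (path_of B D i)" for i
    unfolding path_of_def cliff_shaped_walk by (subst (1 2) row_steps_cliff) (auto simp: D_def)
  then have "cliff_nfamily n (map (path_of B D) [0..<n])"
    using nfamily_path_of[OF rc] by (simp add: cliff_nfamily_def)
  moreover have "diag_matrix n (map (path_of B D) [0..<n]) = B"
    using encode_path_of[OF rc] by (simp add: encode_def)
  ultimately show "B \<in> cliff_codes n" by (force simp: cliff_codes_def)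
qed

section \<open>Assembly of the two bijections\<close>

theorem theorem3:
  fixes n :: nat
  shows "bij_betw (combing n) (cliff_codes n) (disjoint_schroeder_codes n) \<and>
    bij_betw (uncombing n) (disjoint_schroeder_codes n) (cliff_codes n) \<and>
    (\<forall>B \<in> cliff_codes n. uncombing n (combing n B) = B) \<and>
    (\<forall>BD \<in> disjoint_schroeder_codes n. combing n (uncombing n BD) = BD)"
proof -
  let ?C = "cliff_codes n" and ?S = "disjoint_schroeder_codes n"
  have comb: "combing n B \<in> ?S" if "B \<in> ?C" for B
  proof -
    obtain B' D' where "fold (comb_round n) (rev [0..<n]) (B, \<lambda>_ _. 0) = (B', D')"
      by (cases "fold (comb_round n) (rev [0..<n]) (B, \<lambda>_ _. 0)") blast
    then show ?thesis using that comb_inv_rounds[of n n B "\<lambda>_ _. 0" B' D']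
      by (simp add: cliff_codes_eq disjoint_schroeder_codes_eq combing_eq)
  qed
  have inj: "B = C" if "B \<in> ?C" "C \<in> ?C" "combing n B = combing n C" for B C
    using that comb_rounds_inj[of n n B "\<lambda>_ _. 0" C "\<lambda>_ _. 0"] by (simp add: cliff_codes_eq combing_eq)
  have uncomb: "uncombing n BD \<in> ?C" and right: "combing n (uncombing n BD) = BD" if "BD \<in> ?S" for BD
    using that combing_uncombing[of n "fst BD" "snd BD"]
    by (auto simp: cliff_codes_eq disjoint_schroeder_codes_eq)
  \<comment> \<open>Both sides have the same image under combing by \<open>right\<close>, so
    injectivity turns the right inverse into a left inverse.\<close>
  have left: "uncombing n (combing n B) = B" if "B \<in> ?C" for B
    by (rule inj) (use that comb uncomb right in auto)
  have "bij_betw (combing n) ?C ?S" "bij_betw (uncombing n) ?S ?C"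
    by (rule bij_betw_byWitness[where f' = "uncombing n"] bij_betw_byWitness[where f' = "combing n"];
        use left right comb uncomb in auto)+
  then show ?thesis using left right by blast
qed

end
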